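(* Let $R=\bigcup_nR_n$ be an AP equivalence relation on a compact space $X$, with defining sequence $(X_n,\pi_{n,n-1})$, let $D\in Z^1(R,\mathbf{R}_+^* )$, $D_n=D_{|R_n}$, and let $E_n:C(X)\to C(X_n)$ and $\underline E=(E_{n,n-1}:C(X_{n-1})\to C(X_n))_{n\ge1}$ be the associated expectations. (i) The sequence $(S_{D_n}(X))_n$ is decreasing and its intersection is $S_D(X)$. (ii) The isomorphisms $E_n^*:S(X_n)\to S_{D_n}(X)$, $\mu_n\mapsto\mu_n\circ E_n$, induce an isomorphism of compact convex sets from $S(\underline E)$ onto $S_D(X)$ (namely $(\mu_n)_n\mapsto\mu_n\circ E_n=\mu_0$, which does not depend on $n$). In other words, the quasi-invariant probability measures admitting $D$ as Radon-Nikodym derivative are exactly the $G$-measures of $(P_n=\pi_n^*E_n)$, i.e. the probability measures $\mu$ on $X$ such that $\mu=\mu\circ P_n$ for all $n$.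
   Context: $\mathbf{R}_+^*=(0,\infty)$; $C(Y)$ is the space of real continuous functions on a compact space $Y$, and $S(Y)$ is the set of probability measures on $Y$, a compact convex set for the weak-$*$ topology. $X$ is a second countable compact Hausdorff space. AP equivalence relation: one is given $X_0=X$, Hausdorff spaces $X_n$ and surjective local homeomorphisms $\pi_{n,n-1}:X_{n-1}\to X_n$ ($n\ge1$); $\pi_n=\pi_{n,n-1}\circ\dots\circ\pi_{1,0}:X\to X_n$, $\pi_0=\mathrm{id}$; $R_n=\{(x,y)\in X\times X:\pi_n(x)=\pi_n(y)\}$ with the relative product topology; $R=\bigcup_nR_n$ with the inductive limit topology ($W$ open iff $W\cap R_n$ open in $R_n$ for all $n$). $Z^1(R,\mathbf{R}_+^* )$ is the set of continuous $D:R\to\mathbf{R}_+^*$ with $D(x,y)D(y,z)=D(x,z)$; similarly for $R_n$. Normalized potentials: $\rho_n\in C(X,\mathbf{R}_+^* )$ is the unique function such that $D(x,y)=\rho_n(x)/\rho_n(y)$ for $(x,y)\in R_n$ and $\sum_{\pi_n(x)=\omega}\rho_n(x)=1$ for all $\omega\in X_n$; $\rho_{n,n-1}\in C(X_{n-1},\mathbf{R}_+^* )$ is the unique function with $\rho_n=\rho_{n-1}\cdot(\rho_{n,n-1}\circ\pi_{n-1})$. Expectations: $E_n(f)(\omega)=\sum_{\pi_n(x)=\omega}\rho_n(x)f(x)$, $E_{n,n-1}(f)(\omega)=\sum_{\pi_{n,n-1}(z)=\omega}\rho_{n,n-1}(z)f(z)$; one has $E_n=E_{n,n-1}\circ\dots\circ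 E_{1,0}$. $\pi_n^*:C(X_n)\to C(X)$ is $f\mapsto f\circ\pi_n$. $S(\underline E)$ is the set of sequences $(\mu_n)_{n\ge0}$ with $\mu_n\in S(X_n)$ and $\mu_{n-1}=\mu_n\circ E_{n,n-1}$ for all $n\ge1$, a compact convex subset of $\prod_nS(X_n)$. $S_D(X)$ is the set of probability measures $\mu$ on $X$ which are quasi-invariant under $R$ with Radon-Nikodym derivative $D$, that is, $\int\sum_{y:(x,y)\in R}f(x,y)\,d\mu(x)=\int\sum_{x:(x,y)\in R}f(x,y)D(x,y)\,d\mu(y)$ for all $f\in C_c(R)$. $S_{D_n}(X)$ is defined in the same way with $(R_n,D_n)$ instead of $(R,D)$. *)

theory Defs
  imports "HOL-Analysis.Analysis"
begin

section \<open>Approximately proper equivalence relations\<close>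

definition local_homeomorphism :: "'a topology \<Rightarrow> 'b topology \<Rightarrow> ('a \<Rightarrow> 'b) \<Rightarrow> bool" where
  "local_homeomorphism Y Z f \<longleftrightarrow>
     continuous_map Y Z f \<and>
     (\<forall>x\<in>topspace Y. \<exists>U. openin Y U \<and> x \<in> U \<and> openin Z (f ` U) \<and>
        homeomorphic_map (subtopology Y U) (subtopology Z (f ` U)) f)"

text \<open>The spaces \<open>X n\<close> are topologies on one common type: every \<open>X n\<close> is a quotient of \<open>X 0\<close>,
  so its points may always be taken in the type of \<open>X 0\<close>.
  The map \<open>p n\<close> is \<open>\<pi>\<^bsub>n+1,n\<^esub> : X\<^sub>n \<rightarrow> X\<^bsub>n+1\<^esub>\<close>.\<close>

definition AP_sequence :: "(nat \<Rightarrow> 'a topology) \<Rightarrow> (nat \<Rightarrow> 'a \<Rightarrow> 'a) \<Rightarrow> bool" where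
  "AP_sequence X p \<longleftrightarrow>
     compact_space (X 0) \<and> second_countable (X 0) \<and>
     (\<forall>n. Hausdorff_space (X n)) \<and>
     (\<forall>n. local_homeomorphism (X n) (X (Suc n)) (p n) \<and>
          p n ` topspace (X n) = topspace (X (Suc n)))"

primrec proj :: "(nat \<Rightarrow> 'a \<Rightarrow> 'a) \<Rightarrow> nat \<Rightarrow> 'a \<Rightarrow> 'a" where
  "proj p 0 = id"
| "proj p (Suc n) = p n \<circ> proj p n"

definition Rn :: "(nat \<Rightarrow> 'a topology) \<Rightarrow> (nat \<Rightarrow> 'a \<Rightarrow> 'a) \<Rightarrow> nat \<Rightarrow> ('a \<times> 'a) set" where
  "Rn X p n = {(x, y). x \<in> topspace (X 0) \<and> y \<in> topspace (X 0) \<and> proj p n x = proj p n y}"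

definition Rn_top :: "(nat \<Rightarrow> 'a topology) \<Rightarrow> (nat \<Rightarrow> 'a \<Rightarrow> 'a) \<Rightarrow> nat \<Rightarrow> ('a \<times> 'a) topology" where
  "Rn_top X p n = subtopology (prod_topology (X 0) (X 0)) (Rn X p n)"

definition AP_rel :: "(nat \<Rightarrow> 'a topology) \<Rightarrow> (nat \<Rightarrow> 'a \<Rightarrow> 'a) \<Rightarrow> ('a \<times> 'a) set" where
  "AP_rel X p = (\<Union>n. Rn X p n)"

definition R_top :: "(nat \<Rightarrow> 'a topology) \<Rightarrow> (nat \<Rightarrow> 'a \<Rightarrow> 'a) \<Rightarrow> ('a \<times> 'a) topology" where
  "R_top X p =
     topology (\<lambda>W. W \<subseteq> AP_rel X p \<and> (\<forall>n. openin (Rn_top X p n) (W \<inter> Rn X p n)))"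

lemma openin_R_top:
  "openin (R_top X p) W \<longleftrightarrow>
     W \<subseteq> AP_rel X p \<and> (\<forall>n. openin (Rn_top X p n) (W \<inter> Rn X p n))"
proof -
  have "istopology (\<lambda>W. W \<subseteq> AP_rel X p \<and> (\<forall>n. openin (Rn_top X p n) (W \<inter> Rn X p n)))"
    unfolding istopology_def
  proof (intro conjI allI impI)
    fix S T n
    assume S: "S \<subseteq> AP_rel X p \<and> (\<forall>n. openin (Rn_top X p n) (S \<inter> Rn X p n))"
      and T: "T \<subseteq> AP_rel X p \<and> (\<forall>n. openin (Rn_top X p n) (T \<inter> Rn X p n))"
    show "S \<inter> T \<subseteq> AP_rel X p" using S by blast
    have "openin (Rn_top X p n) ((S \<inter> Rn X p n) \<inter> (T \<inter> Rn X p n))"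
      by (rule openin_Int) (use S T in auto)
    moreover have "(S \<inter> Rn X p n) \<inter> (T \<inter> Rn X p n) = S \<inter> T \<inter> Rn X p n"
      by blast
    ultimately show "openin (Rn_top X p n) (S \<inter> T \<inter> Rn X p n)"
      by simp
  next
    fix \<K> :: "('a \<times> 'a) set set" and n
    assume K: "\<forall>W\<in>\<K>. W \<subseteq> AP_rel X p \<and> (\<forall>n. openin (Rn_top X p n) (W \<inter> Rn X p n))"
    show "\<Union>\<K> \<subseteq> AP_rel X p" using K by blast
    have "openin (Rn_top X p n) (\<Union>W\<in>\<K>. W \<inter> Rn X p n)"
      by (rule openin_Union) (use K in auto)
    then show "openin (Rn_top X p n) (\<Union>\<K> \<inter> Rn X p n)"
      by (simp only: Int_Union2)
  qed
  then show ?thesis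
    unfolding R_top_def by (rule topology_inverse'[THEN fun_cong])
qed

lemma topspace_Rn_top: "topspace (Rn_top X p n) = Rn X p n"
  by (auto simp: Rn_top_def Rn_def)

lemma topspace_R_top: "topspace (R_top X p) = AP_rel X p"
proof -
  have "openin (R_top X p) (AP_rel X p)"
    unfolding openin_R_top
  proof (intro conjI allI subset_refl)
    fix n
    have "AP_rel X p \<inter> Rn X p n = topspace (Rn_top X p n)"
      by (auto simp: AP_rel_def topspace_Rn_top)
    then show "openin (Rn_top X p n) (AP_rel X p \<inter> Rn X p n)" by simp
  qed
  then show ?thesis
    using openin_subset openin_R_top[of X p "topspace (R_top X p)"] by blast
qed

text \<open>\<open>Z\<^sup>1(R, (0,\<infinity>))\<close> for an equivalence relation given as the carrier of a topology \<open>T\<close>.\<close>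

definition cocycles :: "('a \<times> 'a) topology \<Rightarrow> ('a \<times> 'a \<Rightarrow> real) set" where
  "cocycles T = {D. continuous_map T euclideanreal D \<and> (\<forall>z\<in>topspace T. 0 < D z) \<and>
     (\<forall>x y z. (x, y) \<in> topspace T \<longrightarrow> (y, z) \<in> topspace T \<longrightarrow> D (x, y) * D (y, z) = D (x, z))}"


section \<open>Continuous functions, probability measures, the weak-* topology\<close>

text \<open>Functions in \<open>Cont Y\<close> and \<open>Cc T\<close> are unconstrained outside the carrier; all notions
  below only use their values on the carrier.\<close>

definition Cont :: "'a topology \<Rightarrow> ('a \<Rightarrow> real) set" where
  "Cont Y = {f. continuous_map Y euclideanreal f}"

definition Cc :: "'a topology \<Rightarrow> ('a \<Rightarrow> real) set" where
  "Cc T = {f. continuous_map T euclideanreal f \<and>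
     compactin T (T closure_of {z \<in> topspace T. f z \<noteq> 0})}"

definition borel_on :: "'a topology \<Rightarrow> 'a measure" where
  "borel_on Y = sigma (topspace Y) {U. openin Y U}"

definition Prob :: "'a topology \<Rightarrow> 'a measure set" where
  "Prob Y = {\<mu>. sets \<mu> = sets (borel_on Y) \<and> emeasure \<mu> (space \<mu>) = 1}"

text \<open>The coarsest topology on \<open>Prob Y\<close> for which all \<open>\<mu> \<mapsto> \<integral>f d\<mu>\<close>, \<open>f \<in> Cont Y\<close>, are continuous.\<close>

definition weak_star :: "'a topology \<Rightarrow> 'a measure topology" where
  "weak_star Y = pullback_topology (Prob Y) (\<lambda>\<mu>. \<lambda>f\<in>Cont Y. \<integral>x. f x \<partial>\<mu>)
     (product_topology (\<lambda>_. euclideanreal) (Cont Y))"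

text \<open>The convex combination \<open>(1 - t) \<mu> + t \<nu>\<close>.\<close>

definition mix :: "real \<Rightarrow> 'a measure \<Rightarrow> 'a measure \<Rightarrow> 'a measure" where
  "mix t \<mu> \<nu> = measure_of (space \<mu>) (sets \<mu>)
     (\<lambda>A. ennreal (1 - t) * emeasure \<mu> A + ennreal t * emeasure \<nu> A)"

lemma sets_mix: "sets (mix t \<mu> \<nu>) = sets \<mu>"
  by (simp add: mix_def)

lemma emeasure_mix:
  assumes "sets \<nu> = sets \<mu>" and "A \<in> sets \<mu>"
  shows "emeasure (mix t \<mu> \<nu>) A = ennreal (1 - t) * emeasure \<mu> A + ennreal t * emeasure \<nu> A"
  unfolding mix_def
proof (rule emeasure_measure_of_sigma)
  show "sigma_algebra (space \<mu>) (sets \<mu>)" by (rule sets.sigma_algebra_axioms)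
  show "positive (sets \<mu>) (\<lambda>A. ennreal (1 - t) * emeasure \<mu> A + ennreal t * emeasure \<nu> A)"
    by (simp add: positive_def)
  show "countably_additive (sets \<mu>)
      (\<lambda>A. ennreal (1 - t) * emeasure \<mu> A + ennreal t * emeasure \<nu> A)"
  proof (rule countably_additiveI)
    fix B :: "nat \<Rightarrow> 'a set"
    assume B: "range B \<subseteq> sets \<mu>" "disjoint_family B"
    have "(\<Sum>i. emeasure \<mu> (B i)) = emeasure \<mu> (\<Union>i. B i)"
      "(\<Sum>i. emeasure \<nu> (B i)) = emeasure \<nu> (\<Union>i. B i)"
      using B assms(1) by (simp_all add: suminf_emeasure)
    then show "(\<Sum>i. ennreal (1 - t) * emeasure \<mu> (B i) + ennreal t * emeasure \<nu> (B i)) =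
        ennreal (1 - t) * emeasure \<mu> (\<Union>i. B i) + ennreal t * emeasure \<nu> (\<Union>i. B i)"
      by (subst suminf_add[symmetric]) (simp_all add: ennreal_suminf_cmult)
  qed
qed (rule assms(2))

text \<open>A compact convex set is given by a compact Hausdorff topology \<open>T\<close> together with the operation
  \<open>c t x y\<close> standing for \<open>(1 - t) x + t y\<close>, under which the carrier has to be closed.\<close>

definition compact_convex :: "'b topology \<Rightarrow> (real \<Rightarrow> 'b \<Rightarrow> 'b \<Rightarrow> 'b) \<Rightarrow> bool" where
  "compact_convex T c \<longleftrightarrow> compact_space T \<and> Hausdorff_space T \<and>
     (\<forall>t\<in>{0..1}. \<forall>x\<in>topspace T. \<forall>y\<in>topspace T. c t x y \<in> topspace T)"

definition compact_convex_iso ::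
  "'b topology \<Rightarrow> (real \<Rightarrow> 'b \<Rightarrow> 'b \<Rightarrow> 'b) \<Rightarrow> 'c topology \<Rightarrow> (real \<Rightarrow> 'c \<Rightarrow> 'c \<Rightarrow> 'c) \<Rightarrow> ('b \<Rightarrow> 'c) \<Rightarrow> bool" where
  "compact_convex_iso T c T' c' F \<longleftrightarrow>
     compact_convex T c \<and> compact_convex T' c' \<and> homeomorphic_map T T' F \<and>
     (\<forall>t\<in>{0..1}. \<forall>x\<in>topspace T. \<forall>y\<in>topspace T. F (c t x y) = c' t (F x) (F y))"


section \<open>Quasi-invariant measures\<close>

text \<open>The carrier of \<open>T\<close> is the equivalence relation. For \<open>f \<in> Cc T\<close> the inner sums
  have only finitely many nonzero terms, although the classes may be infinite.\<close>

definition quasi_invariant ::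
  "'a topology \<Rightarrow> ('a \<times> 'a) topology \<Rightarrow> ('a \<times> 'a \<Rightarrow> real) \<Rightarrow> 'a measure set" where
  "quasi_invariant Y T D = {\<mu> \<in> Prob Y. \<forall>f\<in>Cc T.
     (\<integral>x. (\<Sum>\<^sub>\<infinity>y\<in>{y. (x, y) \<in> topspace T}. f (x, y)) \<partial>\<mu>) =
     (\<integral>y. (\<Sum>\<^sub>\<infinity>x\<in>{x. (x, y) \<in> topspace T}. f (x, y) * D (x, y)) \<partial>\<mu>)}"

definition S_D :: "(nat \<Rightarrow> 'a topology) \<Rightarrow> (nat \<Rightarrow> 'a \<Rightarrow> 'a) \<Rightarrow> ('a \<times> 'a \<Rightarrow> real) \<Rightarrow> 'a measure set" where
  "S_D X p D = quasi_invariant (X 0) (R_top X p) D"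

definition S_Dn ::
  "(nat \<Rightarrow> 'a topology) \<Rightarrow> (nat \<Rightarrow> 'a \<Rightarrow> 'a) \<Rightarrow> ('a \<times> 'a \<Rightarrow> real) \<Rightarrow> nat \<Rightarrow> 'a measure set" where
  "S_Dn X p D n = quasi_invariant (X 0) (Rn_top X p n) (restrict D (Rn X p n))"


section \<open>Normalized potentials and expectations\<close>

text \<open>Restricting to \<open>extensional\<close> functions makes the potentials unique as functions on the type.\<close>

definition rho ::
  "(nat \<Rightarrow> 'a topology) \<Rightarrow> (nat \<Rightarrow> 'a \<Rightarrow> 'a) \<Rightarrow> ('a \<times> 'a \<Rightarrow> real) \<Rightarrow> nat \<Rightarrow> 'a \<Rightarrow> real" where
  "rho X p D n = (THE r. r \<in> extensional (topspace (X 0)) \<and> r \<in> Cont (X 0) \<and>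
     (\<forall>x\<in>topspace (X 0). 0 < r x) \<and>
     (\<forall>x y. (x, y) \<in> Rn X p n \<longrightarrow> D (x, y) = r x / r y) \<and>
     (\<forall>\<omega>\<in>topspace (X n). (\<Sum>x\<in>{x \<in> topspace (X 0). proj p n x = \<omega>}. r x) = 1))"

text \<open>\<open>rho_step X p D n\<close> is \<open>\<rho>\<^bsub>n+1,n\<^esub>\<close> and \<open>E_step X p D n\<close> is \<open>E\<^bsub>n+1,n\<^esub>\<close>.\<close>

definition rho_step ::
  "(nat \<Rightarrow> 'a topology) \<Rightarrow> (nat \<Rightarrow> 'a \<Rightarrow> 'a) \<Rightarrow> ('a \<times> 'a \<Rightarrow> real) \<Rightarrow> nat \<Rightarrow> 'a \<Rightarrow> real" where
  "rho_step X p D n = (THE r. r \<in> extensional (topspace (X n)) \<and> r \<in> Cont (X n) \<and>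
     (\<forall>z\<in>topspace (X n). 0 < r z) \<and>
     (\<forall>x\<in>topspace (X 0). rho X p D (Suc n) x = rho X p D n x * r (proj p n x)))"

definition En ::
  "(nat \<Rightarrow> 'a topology) \<Rightarrow> (nat \<Rightarrow> 'a \<Rightarrow> 'a) \<Rightarrow> ('a \<times> 'a \<Rightarrow> real) \<Rightarrow> nat \<Rightarrow> ('a \<Rightarrow> real) \<Rightarrow> 'a \<Rightarrow> real" where
  "En X p D n f \<omega> = (\<Sum>x\<in>{x \<in> topspace (X 0). proj p n x = \<omega>}. rho X p D n x * f x)"

definition E_step ::
  "(nat \<Rightarrow> 'a topology) \<Rightarrow> (nat \<Rightarrow> 'a \<Rightarrow> 'a) \<Rightarrow> ('a \<times> 'a \<Rightarrow> real) \<Rightarrow> nat \<Rightarrow> ('a \<Rightarrow> real) \<Rightarrow> 'a \<Rightarrow> real" where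
  "E_step X p D n f \<omega> = (\<Sum>z\<in>{z \<in> topspace (X n). p n z = \<omega>}. rho_step X p D n z * f z)"

definition Pn ::
  "(nat \<Rightarrow> 'a topology) \<Rightarrow> (nat \<Rightarrow> 'a \<Rightarrow> 'a) \<Rightarrow> ('a \<times> 'a \<Rightarrow> real) \<Rightarrow> nat \<Rightarrow> ('a \<Rightarrow> real) \<Rightarrow> 'a \<Rightarrow> real" where
  "Pn X p D n f = En X p D n f \<circ> proj p n"

text \<open>\<open>is_comp Y \<nu> L \<mu>\<close> says that \<open>\<nu> = \<mu> \<circ> L\<close> as functionals on \<open>C(Y)\<close>, where probability measures
  act on continuous functions by integration.\<close>

definition is_comp ::
  "'a topology \<Rightarrow> 'a measure \<Rightarrow> (('a \<Rightarrow> real) \<Rightarrow> 'b \<Rightarrow> real) \<Rightarrow> 'b measure \<Rightarrow> bool" where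
  "is_comp Y \<nu> L \<mu> \<longleftrightarrow> (\<forall>f\<in>Cont Y. (\<integral>x. f x \<partial>\<nu>) = (\<integral>\<omega>. L f \<omega> \<partial>\<mu>))"

text \<open>\<open>E_star X p D n \<mu>\<close> is the probability measure on \<open>X 0\<close> representing \<open>\<mu> \<circ> E\<^sub>n\<close>.\<close>

definition E_star ::
  "(nat \<Rightarrow> 'a topology) \<Rightarrow> (nat \<Rightarrow> 'a \<Rightarrow> 'a) \<Rightarrow> ('a \<times> 'a \<Rightarrow> real) \<Rightarrow> nat \<Rightarrow> 'a measure \<Rightarrow> 'a measure" where
  "E_star X p D n \<mu> = (THE \<nu>. \<nu> \<in> Prob (X 0) \<and> is_comp (X 0) \<nu> (En X p D n) \<mu>)"

definition S_E ::
  "(nat \<Rightarrow> 'a topology) \<Rightarrow> (nat \<Rightarrow> 'a \<Rightarrow> 'a) \<Rightarrow> ('a \<times> 'a \<Rightarrow> real) \<Rightarrow> (nat \<Rightarrow> 'a measure) set" where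
  "S_E X p D = {m. (\<forall>n. m n \<in> Prob (X n)) \<and>
     (\<forall>n. is_comp (X n) (m n) (E_step X p D n) (m (Suc n)))}"

definition S_E_top ::
  "(nat \<Rightarrow> 'a topology) \<Rightarrow> (nat \<Rightarrow> 'a \<Rightarrow> 'a) \<Rightarrow> ('a \<times> 'a \<Rightarrow> real) \<Rightarrow> (nat \<Rightarrow> 'a measure) topology" where
  "S_E_top X p D = subtopology (product_topology (\<lambda>n. weak_star (X n)) UNIV) (S_E X p D)"

definition G_measures ::
  "(nat \<Rightarrow> 'a topology) \<Rightarrow> (nat \<Rightarrow> 'a \<Rightarrow> 'a) \<Rightarrow> ('a \<times> 'a \<Rightarrow> real) \<Rightarrow> 'a measure set" where
  "G_measures X p D = {\<mu> \<in> Prob (X 0). \<forall>n. is_comp (X 0) \<mu> (Pn X p D n) \<mu>}"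

end

theory Submission
  imports Defs
begin

text \<open>Everything rests on one description of \<open>S\<^bsub>D\<^sub>n\<^esub>(X)\<close>: it is the set of \<open>\<mu>\<close> with
  \<open>\<mu> = \<mu> \<circ> P\<^sub>n\<close>. Testing quasi-invariance on \<open>f(x,y) = g(x) \<rho>\<^sub>n(y)\<close> gives \<open>\<mu>(g) = \<mu>(P\<^sub>n g)\<close>;
  conversely \<open>E\<^sub>n\<close> takes the same value on both sides of the quasi-invariance equation, since
  \<open>\<rho>\<^sub>n(y) D(x,y) = \<rho>\<^sub>n(x)\<close>. The sequence decreases because \<open>P\<^bsub>n+1\<^esub> P\<^sub>n = P\<^bsub>n+1\<^esub>\<close>, and its
  intersection is \<open>S\<^sub>D(X)\<close> because each \<open>R\<^sub>n\<close> is compact and open in \<open>R\<close>, so that compactly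
  supported functions live on some \<open>R\<^sub>n\<close>. The inverse of \<open>E\<^sub>n\<^sup>*\<close> is the push-forward along \<open>\<pi>\<^sub>n\<close>.

  The existence of \<open>\<mu> \<circ> E\<^sub>n\<close> as a measure and the compactness of the spaces of probability measures
  come from the Riesz representation theorem, obtained from Daniell's outer measure
  \<open>A \<mapsto> inf {\<Sum>\<^sub>n L(f\<^sub>n) | f\<^sub>n \<ge> 0, \<Sum>\<^sub>n f\<^sub>n \<ge> 1 on A}\<close>. Continuity of \<open>\<rho>\<^sub>n\<close>, \<open>E\<^sub>n f\<close> and of the sums over
  classes is one statement about sums over the fibres of a locally injective open map, applied to
  \<open>\<pi>\<^sub>n\<close> and to the projection \<open>R\<^sub>n \<rightarrow> X\<close>.\<close>

section \<open>Riesz representation on compact second countable spaces\<close>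

text \<open>Second countability makes the indicator of every open set an increasing limit of
  continuous functions. This one fact, \<open>open_approximation\<close>, serves both halves of the
  Riesz theorem: open sets split the outer measure additively, and a Borel probability measure is
  determined by its integrals without any regularity assumption. Uniqueness matters as much as
  existence, because \<open>E_star\<close> is a definite description.

  D is continuous only as a function on R, so the sum of D(y,x) over a class, which normalizes the
  potential, is not a sum over the fibres of \<pi>_n of a function on X. It becomes a fibre sum only
  over R_n itself, and this is what brings in the projection of R_n to X.

  The two kinds of isomorphism get their topology in different ways. The source of
  \<open>E_star\<close> is known to be compact, so a continuous bijection is enough. For
  \<open>S_E\<close> compactness is never shown inside the product; it is inherited from S_D through
  an explicit homeomorphism.\<close>

lemma Cont_const: "(\<lambda>_. c) \<in> Cont Y"
  by (simp add: Cont_def)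

lemma Cont_add: "f \<in> Cont Y \<Longrightarrow> g \<in> Cont Y \<Longrightarrow> (\<lambda>x. f x + g x) \<in> Cont Y"
  unfolding Cont_def mem_Collect_eq by (rule continuous_map_add)

lemma Cont_diff: "f \<in> Cont Y \<Longrightarrow> g \<in> Cont Y \<Longrightarrow> (\<lambda>x. f x - g x) \<in> Cont Y"
  unfolding Cont_def mem_Collect_eq by (rule continuous_map_diff)

lemma Cont_mult: "f \<in> Cont Y \<Longrightarrow> g \<in> Cont Y \<Longrightarrow> (\<lambda>x. f x * g x) \<in> Cont Y"
  unfolding Cont_def mem_Collect_eq by (rule continuous_map_real_mult)

lemma Cont_min: "f \<in> Cont Y \<Longrightarrow> g \<in> Cont Y \<Longrightarrow> (\<lambda>x. min (f x) (g x)) \<in> Cont Y"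
  unfolding Cont_def mem_Collect_eq by (rule continuous_map_real_min)

lemma Cont_sum: "(\<And>i. i \<in> I \<Longrightarrow> f i \<in> Cont Y) \<Longrightarrow> (\<lambda>x. \<Sum>i\<in>I. f i x) \<in> Cont Y"
  by (cases "finite I") (simp_all add: Cont_def continuous_map_sum)

lemma Cont_prod: "(\<And>i. i \<in> I \<Longrightarrow> f i \<in> Cont Y) \<Longrightarrow> (\<lambda>x. \<Prod>i\<in>I. f i x) \<in> Cont Y"
  by (cases "finite I") (simp_all add: Cont_def continuous_map_prod)

lemmas Cont_intros = Cont_const Cont_add Cont_diff Cont_mult Cont_min Cont_sum Cont_prod

locale compact_second_countable =
  fixes Y :: "'a topology"
  assumes compact_Y: "compact_space Y" and Hausdorff_Y: "Hausdorff_space Y"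
    and second_countable_Y: "second_countable Y"
begin

text \<open>By regularity U is the union of the countably many basic sets whose closure lies in U;
  Urysohn functions for these are accumulated into one increasing sequence. The conclusion is shaped
  for telescoping: the sequence starts at 0 and, at each point of U, is eventually equal to 1 rather
  than merely convergent to 1.\<close>

lemma open_approximation:
  assumes U: "openin Y U"
  obtains h :: "nat \<Rightarrow> 'a \<Rightarrow> real"
  where "\<And>k. h k \<in> Cont Y" "h 0 = (\<lambda>_. 0)"
    "\<And>k x. x \<in> topspace Y \<Longrightarrow> 0 \<le> h k x" "\<And>k x. x \<in> topspace Y \<Longrightarrow> h k x \<le> 1"
    "\<And>k x. x \<in> topspace Y \<Longrightarrow> h k x \<le> h (Suc k) x"
    "\<And>k x. x \<in> topspace Y \<Longrightarrow> x \<notin> U \<Longrightarrow> h k x = 0"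
    "\<And>x. x \<in> U \<Longrightarrow> \<exists>K. \<forall>k\<ge>K. h k x = 1"
proof -
  obtain \<B> where \<B>: "countable \<B>" "\<And>V. V \<in> \<B> \<Longrightarrow> openin Y V"
    and base: "\<And>U x. openin Y U \<Longrightarrow> x \<in> U \<Longrightarrow> \<exists>V\<in>\<B>. x \<in> V \<and> V \<subseteq> U"
    using second_countable_Y unfolding second_countable_def by metis
  have reg: "neighbourhood_base_of (closedin Y) Y"
    using compact_Hausdorff_imp_regular_space[OF compact_Y Hausdorff_Y] by (simp add: neighbourhood_base_of_closedin)
  have normal: "normal_space Y"
    using compact_Y Hausdorff_Y by (simp add: compact_Hausdorff_or_regular_imp_normal_space)
  \<comment> \<open>The empty set keeps \<open>P\<close> nonempty when no basic set qualifies, so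
    that \<open>from_nat_into\<close> stays inside it.\<close>
  define P where "P = insert {} {B \<in> \<B>. Y closure_of B \<subseteq> U}"
  have P: "countable P" "P \<noteq> {}" using \<B> by (auto simp: P_def)
  have cover: "\<exists>B\<in>P. x \<in> B" if x: "x \<in> U" for x
  proof -
    obtain V C where VC: "openin Y V" "closedin Y C" "x \<in> V" "V \<subseteq> C" "C \<subseteq> U"
      using reg[unfolded neighbourhood_base_of, rule_format, of U x] U x by metis
    then obtain B where B: "B \<in> \<B>" "x \<in> B" "B \<subseteq> V" using base[OF VC(1,3)] by blast
    then have "Y closure_of B \<subseteq> C" by (intro closure_of_minimal order_trans[OF B(3)] VC)
    with B VC have "B \<in> P" by (auto simp: P_def)
    with B show ?thesis by blast
  qed
  have "\<exists>f. f \<in> Cont Y \<and> (\<forall>x\<in>topspace Y. 0 \<le> f x \<and> f x \<le> 1) \<and> (\<forall>x\<in>B. f x = (1::real)) \<and>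
      (\<forall>x\<in>topspace Y - U. f x = 0)" if "B \<in> P" for B
  proof -
    have cl: "closedin Y (topspace Y - U)" using U by blast
    have "disjnt (topspace Y - U) (Y closure_of B)" using that by (auto simp: P_def disjnt_def)
    then obtain f where f: "continuous_map Y (top_of_set {0..1::real}) f"
      "f ` (topspace Y - U) \<subseteq> {0}" "f ` (Y closure_of B) \<subseteq> {1}"
      using Urysohn_lemma[OF normal cl closedin_closure_of, of B 0 1] by auto
    have "B \<subseteq> Y closure_of B"
      using that \<B> by (auto simp: P_def intro!: closure_of_subset openin_subset)
    with f show ?thesis
      by (intro exI[of _ f]) (auto simp: Cont_def continuous_map_in_subtopology image_subset_iff Pi_iff)
  qed
  then have "\<forall>B\<in>P. \<exists>f. f \<in> Cont Y \<and> (\<forall>x\<in>topspace Y. 0 \<le> f x \<and> f x \<le> 1) \<and>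
      (\<forall>x\<in>B. f x = (1::real)) \<and> (\<forall>x\<in>topspace Y - U. f x = 0)" by (rule ballI)
  from bchoice[OF this] obtain F :: "'a set \<Rightarrow> 'a \<Rightarrow> real"
    where F: "\<forall>B\<in>P. F B \<in> Cont Y \<and> (\<forall>x\<in>topspace Y. 0 \<le> F B x \<and> F B x \<le> 1) \<and>
      (\<forall>x\<in>B. F B x = 1) \<and> (\<forall>x\<in>topspace Y - U. F B x = 0)" ..
  define f where "f = (\<lambda>i. F (from_nat_into P i))"
  have inP: "from_nat_into P i \<in> P" for i using P from_nat_into by blast
  have f: "f i \<in> Cont Y" for i using F inP by (simp add: f_def)
  have f01: "0 \<le> 1 - f i x" "1 - f i x \<le> 1" if "x \<in> topspace Y" for i x
    using F inP that by (auto simp: f_def)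
  \<comment> \<open>A product of complements rather than a sum of the \<open>f i\<close>: the values
    stay in [0,1], \<open>h\<close> increases in \<open>k\<close>, and it is exactly 1 once a single
    factor vanishes. The empty product gives \<open>h 0 = 0\<close>.\<close>
  define h where "h = (\<lambda>k x. 1 - (\<Prod>i<k. 1 - f i x))"
  show thesis
  proof
    show "h k \<in> Cont Y" for k
      using f unfolding h_def by (intro Cont_intros)
    show "h 0 = (\<lambda>_. 0)" by (simp add: h_def)
    show "0 \<le> h k x" if "x \<in> topspace Y" for k x
      using f01[OF that] by (auto simp: h_def intro!: prod_le_1)
    show "h k x \<le> 1" if "x \<in> topspace Y" for k x
      using f01[OF that] by (auto simp: h_def intro!: prod_nonneg)
    show "h k x \<le> h (Suc k) x" if "x \<in> topspace Y" for k x
      using f01[OF that] by (auto simp: h_def intro!: mult_left_le prod_nonneg)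
    show "h k x = 0" if "x \<in> topspace Y" "x \<notin> U" for k x
      using F inP that by (simp add: h_def f_def)
    show "\<exists>K. \<forall>k\<ge>K. h k x = 1" if x: "x \<in> U" for x
    proof -
      obtain i where i: "f i x = 1"
        using cover[OF x] F from_nat_into_surj[OF P(1)] unfolding f_def by metis
      have "h k x = 1" if "k \<ge> Suc i" for k
        unfolding h_def using that i by (auto intro!: prod_zero[of "{..<k}"] bexI[of _ i])
      then show ?thesis by blast
    qed
  qed
qed

lemma Cont_bounded:
  assumes "f \<in> Cont Y"
  obtains c where "0 < c" "\<And>x. x \<in> topspace Y \<Longrightarrow> \<bar>f x\<bar> \<le> c"
proof -
  have "compactin euclideanreal (f ` topspace Y)"
    using assms compact_Y image_compactin unfolding Cont_def compact_space_def by blast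
  then obtain c where "0 < c" "\<forall>y\<in>f ` topspace Y. norm y \<le> c"
    using compact_imp_bounded bounded_pos by (metis compactin_euclidean_iff)
  with that show thesis by auto
qed

end

section \<open>Borel probability measures as functionals on continuous functions\<close>

lemma space_borel_on: "space (borel_on Y) = topspace Y"
  by (simp add: borel_on_def openin_subset space_measure_of_conv)

lemma sets_borel_on: "sets (borel_on Y) = sigma_sets (topspace Y) {U. openin Y U}"
  unfolding borel_on_def by (rule sets_measure_of) (auto dest: openin_subset)

lemma Cont_measurable: "f \<in> Cont Y \<Longrightarrow> f \<in> borel_measurable (borel_on Y)"
proof (rule borel_measurableI)
  fix S :: "real set" assume f: "f \<in> Cont Y" and "open S"
  then have "openin Y {x \<in> topspace Y. f x \<in> S}"
    by (simp add: Cont_def openin_continuous_map_preimage)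
  moreover have "f -` S \<inter> space (borel_on Y) = {x \<in> topspace Y. f x \<in> S}"
    by (auto simp: space_borel_on)
  ultimately show "f -` S \<inter> space (borel_on Y) \<in> sets (borel_on Y)"
    by (simp add: sets_borel_on sigma_sets.Basic)
qed

lemma Prob_space: "\<mu> \<in> Prob Y \<Longrightarrow> space \<mu> = topspace Y"
  using sets_eq_imp_space_eq[of \<mu> "borel_on Y"] by (simp add: Prob_def space_borel_on)

lemma Prob_sets: "\<mu> \<in> Prob Y \<Longrightarrow> sets \<mu> = sets (borel_on Y)"
  by (simp add: Prob_def)

lemma Prob_finite: "\<mu> \<in> Prob Y \<Longrightarrow> finite_measure \<mu>"
  by (auto simp: Prob_def intro!: finite_measureI)

lemma Prob_measure_space: "\<mu> \<in> Prob Y \<Longrightarrow> measure \<mu> (topspace Y) = 1"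
proof -
  assume "\<mu> \<in> Prob Y"
  with Prob_space[OF this] show "measure \<mu> (topspace Y) = 1" by (simp add: Prob_def measure_def)
qed

lemma Prob_measurable: "\<mu> \<in> Prob Y \<Longrightarrow> f \<in> Cont Y \<Longrightarrow> f \<in> borel_measurable \<mu>"
  using Cont_measurable[of f Y] measurable_cong_sets[OF Prob_sets[of \<mu> Y] refl] by blast

lemma Prob_integral_cong:
  "\<mu> \<in> Prob Y \<Longrightarrow> (\<And>x. x \<in> topspace Y \<Longrightarrow> f x = g x) \<Longrightarrow> (\<integral>x. f x \<partial>\<mu>) = (\<integral>x. (g x::real) \<partial>\<mu>)"
  by (rule Bochner_Integration.integral_cong) (auto simp: Prob_space)

lemma Prob_integral_const: "\<mu> \<in> Prob Y \<Longrightarrow> (\<integral>x. c \<partial>\<mu>) = (c::real)"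
  by (simp add: Prob_space Prob_measure_space)

text \<open>A positive normalized linear functional on C(Y). Functions are total on the type, but
  linearity together with positivity tested on the carrier makes \<open>L f\<close>, for
  \<open>f\<close> in \<open>Cont Y\<close>, depend only on the values of \<open>f\<close> on the
  carrier.\<close>

definition state :: "'a topology \<Rightarrow> (('a \<Rightarrow> real) \<Rightarrow> real) \<Rightarrow> bool" where
  "state Y L \<longleftrightarrow>
     (\<forall>f\<in>Cont Y. \<forall>g\<in>Cont Y. L (\<lambda>x. f x + g x) = L f + L g) \<and>
     (\<forall>c. \<forall>f\<in>Cont Y. L (\<lambda>x. c * f x) = c * L f) \<and>
     (\<forall>f\<in>Cont Y. (\<forall>x\<in>topspace Y. 0 \<le> f x) \<longrightarrow> 0 \<le> L f) \<and>
     L (\<lambda>_. 1) = 1"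

context compact_second_countable
begin

lemma integrable_Cont: "\<mu> \<in> Prob Y \<Longrightarrow> f \<in> Cont Y \<Longrightarrow> integrable \<mu> f"
proof -
  assume \<mu>: "\<mu> \<in> Prob Y" and f: "f \<in> Cont Y"
  obtain c where "\<And>x. x \<in> topspace Y \<Longrightarrow> \<bar>f x\<bar> \<le> c" using Cont_bounded[OF f] by metis
  then show "integrable \<mu> f"
    using Prob_finite[OF \<mu>] Prob_measurable[OF \<mu> f] Prob_space[OF \<mu>]
    by (intro finite_measure.integrable_const_bound[of _ _ c]) auto
qed

lemma state_integral: "\<mu> \<in> Prob Y \<Longrightarrow> state Y (\<lambda>f. \<integral>x. f x \<partial>\<mu>)"
  unfolding state_def
  by (auto simp: integrable_Cont Prob_integral_const Prob_measure_space Prob_space intro!: Bochner_Integration.integral_nonneg_AE AE_I2)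

lemma integral_open_limit:
  assumes \<mu>: "\<mu> \<in> Prob Y"
    and h: "\<And>k. h k \<in> Cont Y"
    "\<And>k x. x \<in> topspace Y \<Longrightarrow> 0 \<le> h k x" "\<And>k x. x \<in> topspace Y \<Longrightarrow> h k x \<le> 1"
    "\<And>k x. x \<in> topspace Y \<Longrightarrow> x \<notin> U \<Longrightarrow> h k x = 0"
    "\<And>x. x \<in> U \<Longrightarrow> \<exists>K. \<forall>k\<ge>K. h k x = (1::real)"
    and U: "openin Y U"
  shows "(\<lambda>k. \<integral>x. h k x \<partial>\<mu>) \<longlonglongrightarrow> measure \<mu> U"
proof -
  have "(\<lambda>k. \<integral>x. h k x \<partial>\<mu>) \<longlonglongrightarrow> (\<integral>x. indicator U x \<partial>\<mu>)"
  proof (rule integral_dominated_convergence[where w="\<lambda>_. 1"])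
    show "indicat_real U \<in> borel_measurable \<mu>"
      using U Prob_sets[OF \<mu>] by (auto simp: sets_borel_on intro!: borel_measurable_indicator sigma_sets.Basic)
    show "AE x in \<mu>. (\<lambda>k. h k x) \<longlonglongrightarrow> indicat_real U x"
    proof (rule AE_I2)
      fix x assume "x \<in> space \<mu>"
      then have x: "x \<in> topspace Y" by (simp add: Prob_space[OF \<mu>])
      have "eventually (\<lambda>k. h k x = indicat_real U x) sequentially"
        using h(4)[OF x] h(5)[of x] by (cases "x \<in> U") (auto simp: eventually_sequentially)
      then show "(\<lambda>k. h k x) \<longlonglongrightarrow> indicat_real U x" by (rule tendsto_eventually)
    qed
    show "integrable \<mu> (\<lambda>_. 1::real)"
      using Prob_finite[OF \<mu>] by (rule finite_measure.integrable_const)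
    show "AE x in \<mu>. norm (h k x) \<le> 1" for k
      by (rule AE_I2) (use h Prob_space[OF \<mu>] in auto)
  qed (rule Prob_measurable[OF \<mu> h(1)])
  moreover have "U \<inter> space \<mu> = U" using U openin_subset Prob_space[OF \<mu>] by blast
  ultimately show ?thesis by simp
qed

text \<open>Integrals of continuous functions fix the mass of every open set by
  \<open>integral_open_limit\<close>, and the open sets form a generator stable under
  intersection.\<close>

lemma Prob_eqI:
  assumes \<mu>: "\<mu> \<in> Prob Y" and \<nu>: "\<nu> \<in> Prob Y"
    and eq: "\<And>f. f \<in> Cont Y \<Longrightarrow> (\<integral>x. f x \<partial>\<mu>) = (\<integral>x. f x \<partial>\<nu>)"
  shows "\<mu> = \<nu>"
proof (rule measure_eqI_generator_eq[where E="{U. openin Y U}" and \<Omega>="topspace Y" and A="\<lambda>_. topspace Y"])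
  show "Int_stable {U. openin Y U}" by (auto simp: Int_stable_def)
  show "emeasure \<mu> U = emeasure \<nu> U" if "U \<in> {U. openin Y U}" for U
  proof -
    from that have U: "openin Y U" by simp
    obtain h :: "nat \<Rightarrow> 'a \<Rightarrow> real" where h: "\<And>k. h k \<in> Cont Y" "h 0 = (\<lambda>_. 0)"
      "\<And>k x. x \<in> topspace Y \<Longrightarrow> 0 \<le> h k x" "\<And>k x. x \<in> topspace Y \<Longrightarrow> h k x \<le> 1"
      "\<And>k x. x \<in> topspace Y \<Longrightarrow> h k x \<le> h (Suc k) x"
      "\<And>k x. x \<in> topspace Y \<Longrightarrow> x \<notin> U \<Longrightarrow> h k x = 0"
      "\<And>x. x \<in> U \<Longrightarrow> \<exists>K. \<forall>k\<ge>K. h k x = 1"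
      by (rule open_approximation[OF U]) (rule that; assumption)
    have "measure \<mu> U = measure \<nu> U"
      using integral_open_limit[OF \<mu> h(1,3,4,6,7) U] integral_open_limit[OF \<nu> h(1,3,4,6,7) U] eq[OF h(1)]
      by (simp add: LIMSEQ_unique)
    then show ?thesis
      using \<mu> \<nu> by (simp add: finite_measure.emeasure_eq_measure[OF Prob_finite])
  qed
  show "emeasure \<mu> (topspace Y) \<noteq> \<infinity>"
    using \<mu> Prob_space[OF \<mu>] by (simp add: Prob_def)
qed (use \<mu> \<nu> openin_subset in \<open>auto simp: Prob_sets sets_borel_on\<close>)

end

text \<open>Covers in the outer measure below are series, whereas \<open>open_approximation\<close>
  supplies increasing sequences; this converts one into the other.\<close>

lemma suminf_telescope_ennreal:
  fixes a :: "nat \<Rightarrow> real"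
  assumes "a 0 = 0" "\<And>k. a k \<le> a (Suc k)"
  shows "(\<Sum>k. ennreal (a (Suc k) - a k)) = (SUP k. ennreal (a k))"
proof -
  have "(\<Sum>k<n. ennreal (a (Suc k) - a k)) = ennreal (a n)" for n
    using assms by (simp add: sum_ennreal sum_lessThan_telescope)
  then show ?thesis by (simp add: suminf_eq_SUP)
qed

section \<open>Daniell's outer measure of a state\<close>

locale state_on = compact_second_countable Y for Y :: "'a topology" +
  fixes L :: "('a \<Rightarrow> real) \<Rightarrow> real"
  assumes state: "state Y L"
begin

lemma add: "f \<in> Cont Y \<Longrightarrow> g \<in> Cont Y \<Longrightarrow> L (\<lambda>x. f x + g x) = L f + L g"
  and scale: "f \<in> Cont Y \<Longrightarrow> L (\<lambda>x. c * f x) = c * L f"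
  and nonneg: "f \<in> Cont Y \<Longrightarrow> (\<And>x. x \<in> topspace Y \<Longrightarrow> 0 \<le> f x) \<Longrightarrow> 0 \<le> L f"
  and one: "L (\<lambda>_. 1) = 1"
  using state unfolding state_def by blast+

lemma zero: "L (\<lambda>_. 0) = 0" using scale[OF Cont_const, of 0 1] by simp

lemma const: "L (\<lambda>_. c) = c" using scale[OF Cont_const, of c 1] one by simp

lemma diff:
  assumes f: "f \<in> Cont Y" and g: "g \<in> Cont Y"
  shows "L (\<lambda>x. f x - g x) = L f - L g"
proof -
  have "(\<lambda>x. f x - g x) \<in> Cont Y" using f g by (intro Cont_intros; simp?)
  from add[OF this g] show ?thesis by simp
qed

lemma mono:
  assumes "f \<in> Cont Y" "g \<in> Cont Y" "\<And>x. x \<in> topspace Y \<Longrightarrow> f x \<le> g x"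
  shows "L f \<le> L g"
proof -
  have "(\<lambda>x. g x - f x) \<in> Cont Y" using assms by (intro Cont_intros; simp?)
  from nonneg[OF this] diff[of g f] assms show ?thesis by auto
qed

lemma sum:
  assumes "\<And>i. i \<in> I \<Longrightarrow> f i \<in> Cont Y"
  shows "L (\<lambda>x. \<Sum>i\<in>I. f i x) = (\<Sum>i\<in>I. L (f i))"
proof (cases "finite I")
  case True
  then show ?thesis using assms
  proof (induction I)
    case (insert i I)
    have "(\<lambda>x. \<Sum>i\<in>I. f i x) \<in> Cont Y"
      using insert by (intro Cont_intros; simp?)
    with insert show ?case by (simp add: add)
  qed (simp add: zero)
qed (simp add: zero)

text \<open>The pointwise sum is taken in \<open>ennreal\<close>, so a cover carries no convergence
  condition and may sum to infinity.\<close>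

definition covers :: "'a set \<Rightarrow> (nat \<Rightarrow> 'a \<Rightarrow> real) \<Rightarrow> bool" where
  "covers A f \<longleftrightarrow> (\<forall>n. f n \<in> Cont Y \<and> (\<forall>x\<in>topspace Y. 0 \<le> f n x)) \<and>
     (\<forall>x\<in>A. 1 \<le> (\<Sum>n. ennreal (f n x)))"

definition outer :: "'a set \<Rightarrow> ennreal" where
  "outer A = (INF f\<in>Collect (covers A). \<Sum>n. ennreal (L (f n)))"

lemma outer_le: "covers A f \<Longrightarrow> outer A \<le> (\<Sum>n. ennreal (L (f n)))"
  unfolding outer_def by (rule INF_lower) simp

lemma covers_nonneg: "covers A f \<Longrightarrow> 0 \<le> L (f n)"
  unfolding covers_def by (simp add: nonneg)

text \<open>A doubly indexed family is a cover after enumeration by \<open>prod_decode\<close>. It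
  is applied to the union of countably many covers and to the increments in \<open>k\<close> of
  \<open>f n * h k\<close>.\<close>

lemma covers_pairs:
  fixes g :: "nat \<Rightarrow> nat \<Rightarrow> 'a \<Rightarrow> real"
  assumes "\<And>n k. g n k \<in> Cont Y" "\<And>n k x. x \<in> topspace Y \<Longrightarrow> 0 \<le> g n k x"
    "\<And>x. x \<in> A \<Longrightarrow> 1 \<le> (\<Sum>n. \<Sum>k. ennreal (g n k x))"
  shows "outer A \<le> (\<Sum>n. \<Sum>k. ennreal (L (g n k)))"
proof -
  have "covers A (\<lambda>i. case_prod g (prod_decode i))"
    unfolding covers_def
  proof (intro conjI ballI allI)
    fix x assume "x \<in> A"
    then show "1 \<le> (\<Sum>i. ennreal (case_prod g (prod_decode i) x))"
      using assms(3) suminf_ennreal_2dimen[of "\<lambda>n. \<Sum>k. ennreal (g n k x)" "\<lambda>(n, k). ennreal (g n k x)"]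
      by (simp add: case_prod_unfold)
  qed (use assms in \<open>auto simp: case_prod_unfold\<close>)
  from outer_le[OF this] show ?thesis
    using suminf_ennreal_2dimen[of "\<lambda>n. \<Sum>k. ennreal (L (g n k))" "\<lambda>(n, k). ennreal (L (g n k))"]
    by (simp add: case_prod_unfold)
qed

lemma outer_le_one_function:
  assumes "f \<in> Cont Y" "\<And>x. x \<in> topspace Y \<Longrightarrow> 0 \<le> f x" "\<And>x. x \<in> A \<Longrightarrow> 1 \<le> f x"
  shows "outer A \<le> ennreal (L f)"
proof -
  define g where "g = (\<lambda>n::nat. if n = 0 then f else (\<lambda>_. 0))"
  have s: "(\<Sum>n. ennreal (F (g n))) = ennreal (F f)" if "F (\<lambda>_. 0) = 0" for F :: "('a \<Rightarrow> real) \<Rightarrow> real"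
    by (subst suminf_finite[of "{0}"]) (auto simp: g_def that)
  have "covers A g"
    unfolding covers_def using assms s[of "\<lambda>f. f _"] by (auto simp: g_def Cont_const)
  from outer_le[OF this] show ?thesis using s[of L] by (simp add: zero)
qed

lemma outer_empty: "outer {} = 0"
  using outer_le_one_function[of "\<lambda>_. 0" "{}"] by (simp add: Cont_const zero)

lemma outer_mono: "A \<subseteq> B \<Longrightarrow> outer A \<le> outer B"
  unfolding outer_def by (rule INF_superset_mono) (auto simp: covers_def subset_iff)

lemma outer_close: "outer A < c \<Longrightarrow> \<exists>f. covers A f \<and> (\<Sum>n. ennreal (L (f n))) < c"
  unfolding outer_def INF_less_iff by blast

lemma outer_subadditive: "outer (\<Union>i. A i) \<le> (\<Sum>i. outer (A i))" for A :: "nat \<Rightarrow> 'a set"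
proof (rule ennreal_le_epsilon)
  fix e :: real assume "0 < e" and "(\<Sum>i. outer (A i)) < top"
  \<comment> \<open>Finiteness of the sum makes each term finite, and only for a finite term does
    adding a positive number give a strict inequality.\<close>
  then have "outer (A n) < outer (A n) + e * (1/2)^Suc n" for n
    by (auto simp add: less_top dest!: ennreal_suminf_lessD)
  from outer_close[OF this]
  have "\<exists>f. covers (A n) f \<and> (\<Sum>k. ennreal (L (f k))) \<le> outer (A n) + e * (1/2)^Suc n" for n
    by (blast intro: less_imp_le)
  then obtain f where f: "\<And>n. covers (A n) (f n)"
    "\<And>n. (\<Sum>k. ennreal (L (f n k))) \<le> outer (A n) + e * (1/2)^Suc n"
    by metis
  have "outer (\<Union>i. A i) \<le> (\<Sum>n. \<Sum>k. ennreal (L (f n k)))"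
  proof (rule covers_pairs)
    fix x assume "x \<in> (\<Union>i. A i)"
    then obtain i where "x \<in> A i" by blast
    with f(1)[of i] have "1 \<le> (\<Sum>k. ennreal (f i k x))" by (simp add: covers_def)
    also have "\<dots> \<le> (\<Sum>n. \<Sum>k. ennreal (f n k x))"
      using sum_le_suminf[of "\<lambda>n. \<Sum>k. ennreal (f n k x)" "{i}"] by simp
    finally show "1 \<le> (\<Sum>n. \<Sum>k. ennreal (f n k x))" .
  qed (use f(1) in \<open>auto simp: covers_def\<close>)
  also have "\<dots> \<le> (\<Sum>n. outer (A n) + e * (1/2)^Suc n)"
    by (intro suminf_le f) auto
  also have "... = (\<Sum>n. outer (A n)) + (\<Sum>n. ennreal e * ennreal ((1/2) ^ Suc n))"
    using \<open>0 < e\<close> by (subst suminf_add[symmetric])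
      (auto simp del: ennreal_suminf_cmult simp add: ennreal_mult[symmetric])
  also have "\<dots> = (\<Sum>n. outer (A n)) + e"
    unfolding ennreal_suminf_cmult
    by (subst suminf_ennreal_eq[OF zero_le_power power_half_series]) auto
  finally show "outer (\<Union>i. A i) \<le> (\<Sum>i. outer (A i)) + e" .
qed

text \<open>Caratheodory's condition for an open set, one cover at a time. Multiplying by
  \<open>h k\<close> and by \<open>1 - h k\<close> splits each \<open>f n\<close> into a part
  supported in U and a part that still covers the points outside U, and L is additive on the two
  parts.\<close>

lemma outer_split_cover:
  assumes U: "openin Y U" and A: "A \<subseteq> topspace Y" and f: "covers A f"
  shows "outer (A \<inter> U) + outer (A - U) \<le> (\<Sum>n. ennreal (L (f n)))"
proof -
  obtain h :: "nat \<Rightarrow> 'a \<Rightarrow> real" where h: "\<And>k. h k \<in> Cont Y" "h 0 = (\<lambda>_. 0)"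
    "\<And>k x. x \<in> topspace Y \<Longrightarrow> 0 \<le> h k x" "\<And>k x. x \<in> topspace Y \<Longrightarrow> h k x \<le> 1"
    "\<And>k x. x \<in> topspace Y \<Longrightarrow> h k x \<le> h (Suc k) x"
    "\<And>k x. x \<in> topspace Y \<Longrightarrow> x \<notin> U \<Longrightarrow> h k x = 0"
    "\<And>x. x \<in> U \<Longrightarrow> \<exists>K. \<forall>k\<ge>K. h k x = 1"
    by (rule open_approximation[OF U]) (rule that; assumption)
  have fC: "f n \<in> Cont Y" for n using f by (simp add: covers_def)
  have f0: "0 \<le> f n x" if "x \<in> topspace Y" for n x using f that by (simp add: covers_def)
  have f1: "1 \<le> (\<Sum>n. ennreal (f n x))" if "x \<in> A" for x using f that by (simp add: covers_def)
  have fhC: "(\<lambda>x. f n x * h k x) \<in> Cont Y" for n k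
    using fC h(1) by (intro Cont_intros; simp?)
  have fhd: "f n x * h k x \<le> f n x * h (Suc k) x" if "x \<in> topspace Y" for n k x
    using f0 h(5) that by (simp add: mult_left_mono)
  define a where "a = (\<lambda>n k. L (\<lambda>x. f n x * h k x))"
  have a0: "a n 0 = 0" for n by (simp add: a_def h(2) zero)
  have a1: "a n k \<le> a n (Suc k)" for n k
    unfolding a_def by (rule mono) (use fhC fhd in auto)
  have ann: "0 \<le> a n k" for n k
    unfolding a_def by (rule nonneg) (use fhC f0 h in auto)
  \<comment> \<open>In general no single \<open>h k\<close> is 1 on all of U, so for fixed
    \<open>k\<close> the products \<open>f n * h k\<close> need not cover. Their increments in
    \<open>k\<close> do, as they telescope from \<open>h 0 = 0\<close> to the supremum.\<close>
  have in_U: "outer (A \<inter> U) \<le> (\<Sum>n. SUP k. ennreal (a n k))"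
  proof -
    have "outer (A \<inter> U) \<le> (\<Sum>n. \<Sum>k. ennreal (L (\<lambda>x. f n x * h (Suc k) x - f n x * h k x)))"
    proof (rule covers_pairs)
      show "(\<lambda>x. f n x * h (Suc k) x - f n x * h k x) \<in> Cont Y" for n k
        by (rule Cont_diff[OF fhC fhC])
      show "0 \<le> f n x * h (Suc k) x - f n x * h k x" if "x \<in> topspace Y" for n k x
        using fhd[OF that] by simp
      fix x assume x: "x \<in> A \<inter> U"
      then have xY: "x \<in> topspace Y" using A by blast
      have "x \<in> U" using x by (rule IntD2)
      from h(7)[OF this] obtain K where "\<forall>k\<ge>K. h k x = 1" ..
      then have K: "h K x = 1" by simp
      have "ennreal (f n x) \<le> (\<Sum>k. ennreal (f n x * h (Suc k) x - f n x * h k x))" for n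
      proof -
        have "(\<Sum>k. ennreal (f n x * h (Suc k) x - f n x * h k x)) = (SUP k. ennreal (f n x * h k x))"
        proof (rule suminf_telescope_ennreal)
          show "f n x * h 0 x = 0" by (simp add: h(2))
        qed (rule fhd[OF xY])
        moreover have "ennreal (f n x) \<le> (SUP k. ennreal (f n x * h k x))"
          by (rule SUP_upper2[of K]) (simp, simp only: K mult_1_right order_refl)
        ultimately show ?thesis by (simp only:)
      qed
      then have "(\<Sum>n. ennreal (f n x)) \<le> (\<Sum>n. \<Sum>k. ennreal (f n x * h (Suc k) x - f n x * h k x))"
        by (intro suminf_le) auto
      then show "1 \<le> (\<Sum>n. \<Sum>k. ennreal (f n x * h (Suc k) x - f n x * h k x))"
        by (rule order_trans[OF f1[OF IntD1[OF x]]])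
    qed
    also have "\<dots> = (\<Sum>n. \<Sum>k. ennreal (a n (Suc k) - a n k))"
      by (simp add: diff fhC a_def)
    also have "\<dots> = (\<Sum>n. SUP k. ennreal (a n k))"
      by (simp only: suminf_telescope_ennreal[of "a n" for n, OF a0 a1])
    finally show ?thesis .
  qed
  \<comment> \<open>Outside U one fixed \<open>k\<close> suffices, because \<open>h k\<close>
    vanishes there.\<close>
  have out_U: "(\<Sum>n. ennreal (a n k)) + outer (A - U) \<le> (\<Sum>n. ennreal (L (f n)))" for k
  proof -
    have d: "(\<lambda>x. f n x - f n x * h k x) \<in> Cont Y" for n
      by (rule Cont_diff[OF fC fhC])
    have d0: "0 \<le> f n x - f n x * h k x" if "x \<in> topspace Y" for n x
      using f0[OF that] h(4)[OF that] by (simp add: mult_left_le)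
    have "covers (A - U) (\<lambda>n x. f n x - f n x * h k x)"
      unfolding covers_def
    proof (intro conjI ballI allI)
      fix x assume x: "x \<in> A - U"
      then have "h k x = 0" using A h(6) by blast
      with f1[of x] x show "1 \<le> (\<Sum>n. ennreal (f n x - f n x * h k x))" by simp
    qed (fact d d0)+
    from outer_le[OF this] have "outer (A - U) \<le> (\<Sum>n. ennreal (L (f n) - a n k))"
      by (simp add: diff fC fhC a_def)
    then have "(\<Sum>n. ennreal (a n k)) + outer (A - U) \<le> (\<Sum>n. ennreal (a n k)) + (\<Sum>n. ennreal (L (f n) - a n k))"
      by (rule add_left_mono)
    also have "\<dots> = (\<Sum>n. ennreal (a n k) + ennreal (L (f n) - a n k))"
      by (simp add: suminf_add)
    also have "\<dots> = (\<Sum>n. ennreal (L (f n)))"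
    proof -
      have "0 \<le> L (f n) - a n k" for n
        using nonneg[OF d d0] by (simp add: diff fC fhC a_def)
      then show ?thesis using ann by (simp flip: ennreal_plus)
    qed
    finally show ?thesis .
  qed
  \<comment> \<open>Monotone convergence moves the supremum outside the series, so that the same
    \<open>k\<close> serves both parts.\<close>
  have "(\<Sum>n. SUP k. ennreal (a n k)) = (SUP k. \<Sum>n. ennreal (a n k))"
    by (rule ennreal_suminf_SUP_eq) (use a1 in \<open>auto simp: incseq_Suc_iff intro!: ennreal_leI\<close>)
  then have "outer (A \<inter> U) + outer (A - U) \<le> (SUP k. \<Sum>n. ennreal (a n k)) + outer (A - U)"
    using in_U by (simp add: add_right_mono)
  also have "\<dots> = (SUP k. (\<Sum>n. ennreal (a n k)) + outer (A - U))"
    by (rule ennreal_SUP_add_left[symmetric]) simp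
  also have "\<dots> \<le> (\<Sum>n. ennreal (L (f n)))" by (rule SUP_least) (rule out_U)
  finally show ?thesis .
qed

lemma outer_split:
  assumes "openin Y U" "A \<subseteq> topspace Y"
  shows "outer (A \<inter> U) + outer (A - U) = outer A"
proof (rule antisym)
  show "outer (A \<inter> U) + outer (A - U) \<le> outer A"
    unfolding outer_def[of A] using outer_split_cover[OF assms] by (intro INF_greatest) auto
  have "outer A \<le> outer (\<Union>i. binaryset (A \<inter> U) (A - U) i)"
    by (rule outer_mono) (auto simp: UN_binaryset_eq)
  also have "\<dots> \<le> (\<Sum>i. outer (binaryset (A \<inter> U) (A - U) i))" by (rule outer_subadditive)
  also have "\<dots> = outer (A \<inter> U) + outer (A - U)"
    by (rule suminf_binaryset_eq) (rule outer_empty)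
  finally show "outer A \<le> outer (A \<inter> U) + outer (A - U)" .
qed

text \<open>A Dini argument: L handles only finite sums, and compactness turns the pointwise bound
  on the series into the bound \<open>1 - e\<close> for one finite partial sum. This keeps the outer
  measure from being too small.\<close>

lemma one_le_outer: "1 \<le> outer (topspace Y)"
  unfolding outer_def
proof (rule INF_greatest)
  fix f assume "f \<in> Collect (covers (topspace Y))"
  then have f: "covers (topspace Y) f" by simp
  then have fC: "f n \<in> Cont Y" and f0: "x \<in> topspace Y \<Longrightarrow> 0 \<le> f n x" for n x
    by (auto simp: covers_def)
  show "1 \<le> (\<Sum>n. ennreal (L (f n)))"
  proof (rule ennreal_le_epsilon)
    fix e :: real assume e: "0 < e"
    define S where "S = (\<lambda>N x. \<Sum>n<N. f n x)"
    have SC: "S N \<in> Cont Y" for N using fC unfolding S_def by (intro Cont_intros; simp?)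
    define V where "V = (\<lambda>N. {x \<in> topspace Y. S N x \<in> {1 - e<..}})"
    have Vo: "openin Y (V N)" for N
      unfolding V_def using SC by (intro openin_continuous_map_preimage) (auto simp: Cont_def)
    have Vm: "V M \<subseteq> V N" if "M \<le> N" for M N
    proof
      fix x assume x: "x \<in> V M"
      have "S M x \<le> S N x" unfolding S_def using that x f0
        by (intro sum_mono2) (auto simp: V_def)
      with x show "x \<in> V N" by (auto simp: V_def)
    qed
    have "topspace Y \<subseteq> \<Union>(range V)"
    proof
      fix x assume x: "x \<in> topspace Y"
      have "ennreal (1 - e) < 1" using e by (simp add: ennreal_less_one_iff)
      also have "1 \<le> (\<Sum>n. ennreal (f n x))" using f x by (simp add: covers_def)
      finally have "ennreal (1 - e) < (SUP N. \<Sum>n<N. ennreal (f n x))" by (simp add: suminf_eq_SUP)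
      then obtain N where "ennreal (1 - e) < (\<Sum>n<N. ennreal (f n x))" by (auto simp: less_SUP_iff)
      then have "1 - e < S N x"
        using f0[OF x] unfolding S_def
        by (simp add: sum_ennreal ennreal_less_iff[OF sum_nonneg] flip: not_le) (meson ennreal_leI not_le)
      with x show "x \<in> \<Union>(range V)" by (auto simp: V_def)
    qed
    then obtain F where F: "finite F" "F \<subseteq> range V" "topspace Y \<subseteq> \<Union>F"
      using compact_Y Vo compactinD[of Y "topspace Y" "range V"] unfolding compact_space_def by blast
    then obtain J where J: "finite J" "F = V ` J" by (metis finite_subset_image)
    \<comment> \<open>\<open>Max\<close> needs a nonempty set; when \<open>J\<close> is empty so is
      the space, and any value does.\<close>
    define N where "N = (if J = {} then 0 else Max J)"
    have "topspace Y \<subseteq> V N"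
    proof
      fix x assume "x \<in> topspace Y"
      then obtain j where j: "j \<in> J" "x \<in> V j" using F J by auto
      then have "j \<le> N" using J by (auto simp: N_def)
      with j Vm show "x \<in> V N" by blast
    qed
    then have "L (\<lambda>_. 1 - e) \<le> L (S N)"
      by (intro mono Cont_const SC) (auto simp: V_def less_imp_le)
    then have "1 \<le> L (S N) + e" by (simp add: const)
    also have "L (S N) = (\<Sum>n<N. L (f n))" unfolding S_def by (rule sum) (rule fC)
    finally have "ennreal 1 \<le> ennreal ((\<Sum>n<N. L (f n)) + e)" by (rule ennreal_leI)
    also have "\<dots> = (\<Sum>n<N. ennreal (L (f n))) + e"
      using covers_nonneg[OF f] e by (simp add: ennreal_plus sum_nonneg sum_ennreal)
    also have "\<dots> \<le> (\<Sum>n. ennreal (L (f n))) + e"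
      by (intro add_right_mono sum_le_suminf) auto
    finally show "1 \<le> (\<Sum>n. ennreal (L (f n))) + e" by simp
  qed
qed

section \<open>The measure representing a state\<close>

definition riesz :: "'a measure" where
  "riesz = measure_of (topspace Y) {U. openin Y U} outer"

lemma sets_riesz: "sets riesz = sets (borel_on Y)"
  unfolding riesz_def sets_borel_on by (rule sets_measure_of) (auto dest: openin_subset)

lemma space_riesz: "space riesz = topspace Y"
  using sets_eq_imp_space_eq[OF sets_riesz] by (simp add: space_borel_on)

text \<open>\<open>outer\<close> is countably additive on its Caratheodory-measurable sets. These
  contain the open sets by \<open>outer_split\<close>, hence the whole Borel algebra, to which the
  measure is restricted.\<close>

lemma emeasure_riesz:
  assumes "A \<in> sets riesz" shows "emeasure riesz A = outer A"
proof -
  interpret P: sigma_algebra "topspace Y" "Pow (topspace Y)" by (rule sigma_algebra_Pow)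
  have "outer_measure_space (Pow (topspace Y)) outer"
    unfolding outer_measure_space_def positive_def increasing_def countably_subadditive_def
    using outer_mono outer_empty outer_subadditive by simp
  from P.caratheodory_lemma[OF this]
  have ms: "measure_space (topspace Y) (lambda_system (topspace Y) (Pow (topspace Y)) outer) outer" .
  have op: "{U. openin Y U} \<subseteq> lambda_system (topspace Y) (Pow (topspace Y)) outer"
    unfolding P.lambda_system_eq
  proof
    fix U assume "U \<in> {U. openin Y U}"
    then show "U \<in> {l \<in> Pow (topspace Y). \<forall>x\<in>Pow (topspace Y). outer (x \<inter> l) + outer (x - l) = outer x}"
      by (simp add: openin_subset outer_split)
  qed
  have "sigma_algebra (topspace Y) (lambda_system (topspace Y) (Pow (topspace Y)) outer)"
    using ms by (simp add: measure_space_def)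
  from sigma_algebra.sigma_sets_subset[OF this op]
  have "measure_space (topspace Y) (sigma_sets (topspace Y) {U. openin Y U}) outer"
    using ms by (intro measure_down[OF ms sigma_algebra_sigma_sets]) (auto dest: openin_subset)
  then show ?thesis
    using assms unfolding measure_space_def sets_riesz sets_borel_on
    by (intro emeasure_measure_of[OF riesz_def]) (auto dest: openin_subset simp: sets_riesz sets_borel_on)
qed

lemma riesz_Prob: "riesz \<in> Prob Y"
proof -
  have "outer (topspace Y) \<le> 1"
    using outer_le_one_function[of "\<lambda>_. 1" "topspace Y"] by (simp add: Cont_const one)
  with one_le_outer have "outer (topspace Y) = 1" by (rule antisym[rotated])
  then show ?thesis
    using emeasure_riesz[OF sets.top] by (simp add: Prob_def sets_riesz space_riesz)
qed

text \<open>Cutting \<open>f\<close> into the slices \<open>min f ((i+1)/N) - min f (i/N)\<close>, each of which is \<open>1/N\<close>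
  wherever the next one is nonzero, compares \<open>L f\<close> with a Riemann sum of the layer cake integral.\<close>

lemma integral_riesz_le_unit:
  assumes f: "f \<in> Cont Y" and f0: "\<And>x. x \<in> topspace Y \<Longrightarrow> 0 \<le> f x"
    and f1: "\<And>x. x \<in> topspace Y \<Longrightarrow> f x \<le> 1"
  shows "(\<integral>x. f x \<partial>riesz) \<le> L f"
proof -
  interpret finite_measure riesz by (rule Prob_finite[OF riesz_Prob])
  have "(\<integral>x. f x \<partial>riesz) \<le> L f + 1 / real (Suc N)" for N
  proof -
    \<comment> \<open>\<open>Suc N\<close> slices of height \<open>1 / M\<close> reach exactly up to
      1, the bound on \<open>f\<close>.\<close>
    define M where "M = real (Suc N)"
    have M: "0 < M" "M = 1 + real N" by (auto simp: M_def)
    define \<phi> where "\<phi> = (\<lambda>i x. min (f x) (real (Suc i) / M) - min (f x) (real i / M))"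
    have \<phi>C: "\<phi> i \<in> Cont Y" for i
      using f unfolding \<phi>_def by (intro Cont_intros; simp?)
    have le: "real i / M \<le> real (Suc i) / M" for i using M by (simp add: divide_right_mono)
    have step: "real (Suc i) / M = real i / M + 1 / M" for i by (simp add: add_divide_distrib)
    have \<phi>0: "0 \<le> \<phi> i x" for i x using le[of i] by (auto simp: \<phi>_def)
    have sum_\<phi>: "(\<Sum>i<Suc N. \<phi> i x) = f x" if "x \<in> topspace Y" for x
    proof -
      have "(\<Sum>i<Suc N. \<phi> i x) = min (f x) (real (Suc N) / M) - min (f x) (real 0 / M)"
        unfolding \<phi>_def by (rule sum_lessThan_telescope)
      then show ?thesis using f0[OF that] f1[OF that] by (simp add: M_def)
    qed
    define A where "A = (\<lambda>i. {x \<in> topspace Y. real (Suc i) / M \<le> f x})"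
    have A: "A i \<in> sets riesz" for i
    proof -
      have "{x \<in> space (borel_on Y). real (Suc i) / M \<le> f x} \<in> sets (borel_on Y)"
        using Cont_measurable[OF f] by measurable
      then show ?thesis by (simp add: A_def sets_riesz space_borel_on)
    qed
    have meas: "measure riesz (A i) \<le> M * L (\<phi> i)" for i
    proof -
      have "outer (A i) \<le> ennreal (L (\<lambda>x. M * \<phi> i x))"
      proof (rule outer_le_one_function)
        show "(\<lambda>x. M * \<phi> i x) \<in> Cont Y"
          using \<phi>C by (intro Cont_intros; simp?)
        fix x assume "x \<in> A i"
        then have a: "real (Suc i) / M \<le> f x" by (simp add: A_def)
        with le[of i] have b: "real i / M \<le> f x" by linarith
        have "\<phi> i x = 1 / M"
          by (simp add: \<phi>_def min_absorb2[OF b] min_absorb2[OF a[unfolded step]] step del: of_nat_Suc)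
        then show "1 \<le> M * \<phi> i x" using M(1) by simp
      qed (use \<phi>0 M in auto)
      moreover have "0 \<le> M * L (\<phi> i)" using M nonneg[OF \<phi>C \<phi>0] by simp
      ultimately show ?thesis
        using emeasure_riesz[OF A[of i]]
        by (simp add: scale \<phi>C emeasure_eq_measure flip: ennreal_le_iff)
    qed
    \<comment> \<open>An index shift: slice \<open>i\<close> bounds the mass of \<open>A i\<close>,
      while the indicator of \<open>A i\<close> bounds slice \<open>i + 1\<close>. The unmatched
      slice 0 is the error \<open>1 / M\<close>.\<close>
    have bound: "f x \<le> 1 / M + (\<Sum>i<N. indicator (A i) x / M)" if x: "x \<in> topspace Y" for x
    proof -
      have "f x = \<phi> 0 x + (\<Sum>i<N. \<phi> (Suc i) x)"
        using sum_\<phi>[OF x] by (simp only: sum.lessThan_Suc_shift)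
      also have "\<phi> 0 x \<le> 1 / M" using f0[OF x] by (auto simp: \<phi>_def)
      also have "(\<Sum>i<N. \<phi> (Suc i) x) \<le> (\<Sum>i<N. indicator (A i) x / M)"
      proof (rule sum_mono)
        fix i
        show "\<phi> (Suc i) x \<le> indicator (A i) x / M"
        proof (cases "x \<in> A i")
          case True
          have "min (f x) (real (Suc (Suc i)) / M) - min (f x) (real (Suc i) / M) \<le> 1 / M"
            using step[of "Suc i"] le[of "Suc i"] M(1) by (simp only: min_def split: if_splits) linarith
          with True show ?thesis by (simp add: \<phi>_def)
        next
          case False
          then have "f x \<le> real (Suc i) / M" using x by (simp add: A_def)
          moreover from this le[of "Suc i"] have "f x \<le> real (Suc (Suc i)) / M" by linarith
          ultimately show ?thesis using False by (simp only: \<phi>_def min_absorb1) simp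
        qed
      qed
      finally show ?thesis by simp
    qed
    have "(\<integral>x. f x \<partial>riesz) \<le> (\<integral>x. 1 / M + (\<Sum>i<N. indicator (A i) x / M) \<partial>riesz)"
    proof (rule integral_mono)
      show "integrable riesz f" by (rule integrable_Cont[OF riesz_Prob f])
      show "integrable riesz (\<lambda>x. 1 / M + (\<Sum>i<N. indicator (A i) x / M))"
        using A by (auto intro!: integrable_real_indicator simp: less_top[symmetric])
    qed (use bound space_riesz in auto)
    also have "\<dots> = 1 / M + (\<Sum>i<N. measure riesz (A i) / M)"
    proof -
      have "A i \<inter> space riesz = A i" for i by (auto simp: A_def space_riesz)
      moreover have "integrable riesz (\<lambda>x. indicat_real (A i) x / M)" for i
        using A[of i] by (auto intro!: integrable_real_indicator simp: less_top[symmetric])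
      ultimately show ?thesis
        using Prob_integral_const[OF riesz_Prob, of "1 / M"]
        by (simp add: Bochner_Integration.integral_sum)
    qed
    also have "\<dots> \<le> 1 / M + (\<Sum>i<N. L (\<phi> i))"
      using meas M by (intro add_left_mono sum_mono) (simp add: field_simps)
    also have "(\<Sum>i<N. L (\<phi> i)) \<le> (\<Sum>i<Suc N. L (\<phi> i))" using nonneg[OF \<phi>C \<phi>0] by simp
    also have "\<dots> = L (\<lambda>x. \<Sum>i<Suc N. \<phi> i x)" by (rule sum[symmetric]) (rule \<phi>C)
    also have "\<dots> \<le> L f"
      by (rule mono[OF Cont_sum[OF \<phi>C] f]) (simp only: sum_\<phi> order_refl)
    finally show ?thesis by (simp add: M_def)
  qed
  moreover have "(\<lambda>N. L f + 1 / real (Suc N)) \<longlonglongrightarrow> L f + 0"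
    by (intro tendsto_add tendsto_const) (use LIMSEQ_inverse_real_of_nat in \<open>simp add: inverse_eq_divide\<close>)
  ultimately show ?thesis by (intro LIMSEQ_le_const[of _ "L f"]) auto
qed

text \<open>An affine change brings \<open>f\<close> into [0,1]. Both sides agree on constants,
  since \<open>riesz\<close> has mass 1 and L is normalized, so the inequality can be carried
  back.\<close>

lemma integral_riesz_le:
  assumes f: "f \<in> Cont Y" shows "(\<integral>x. f x \<partial>riesz) \<le> L f"
proof -
  obtain c where c: "0 < c" "\<And>x. x \<in> topspace Y \<Longrightarrow> \<bar>f x\<bar> \<le> c" by (rule Cont_bounded[OF f]) (rule that; assumption)
  define g where "g = (\<lambda>x. 1 / (2 * c) * (f x + c))"
  have fc: "(\<lambda>x. f x + c) \<in> Cont Y" using f by (intro Cont_intros; simp?)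
  have g: "g \<in> Cont Y" using f unfolding g_def by (intro Cont_intros; simp?)
  have "(\<integral>x. g x \<partial>riesz) \<le> L g"
  proof (rule integral_riesz_le_unit[OF g])
    fix x assume "x \<in> topspace Y"
    from c(2)[OF this] c(1) show "0 \<le> g x" "g x \<le> 1" by (auto simp: g_def field_simps)
  qed
  also have "L g = 1 / (2 * c) * (L f + c)"
    unfolding g_def by (simp only: scale[OF fc] add[OF f Cont_const] const)
  also have "(\<integral>x. g x \<partial>riesz) = 1 / (2 * c) * ((\<integral>x. f x \<partial>riesz) + c)"
    unfolding g_def
    using Bochner_Integration.integral_add[OF integrable_Cont[OF riesz_Prob f]
        integrable_Cont[OF riesz_Prob Cont_const[of c]]] Prob_integral_const[OF riesz_Prob, of c]
    by simp
  finally show ?thesis using c(1) by (simp add: divide_le_cancel)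
qed

text \<open>Linearity turns the upper bound for \<open>-f\<close> into the lower bound for
  \<open>f\<close>, so one-sided Riemann sums suffice.\<close>

lemma integral_riesz:
  assumes f: "f \<in> Cont Y" shows "(\<integral>x. f x \<partial>riesz) = L f"
proof (rule antisym[OF integral_riesz_le[OF f]])
  have "(\<lambda>x. (-1) * f x) \<in> Cont Y" using f by (intro Cont_intros; simp?)
  from integral_riesz_le[OF this] scale[OF f, of "-1"]
  show "L f \<le> (\<integral>x. f x \<partial>riesz)" by simp
qed

end

theorem (in compact_second_countable) riesz_representation:
  assumes "state Y L"
  shows "\<exists>!\<nu>. \<nu> \<in> Prob Y \<and> (\<forall>f\<in>Cont Y. (\<integral>x. f x \<partial>\<nu>) = L f)"
proof -
  interpret state_on Y L by unfold_locales (rule assms)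
  show ?thesis
    using riesz_Prob integral_riesz Prob_eqI by (intro ex1I[of _ riesz]) auto
qed

section \<open>The weak-* topology and convex combinations\<close>

lemma topspace_weak_star: "topspace (weak_star Y) = Prob Y"
  by (auto simp: weak_star_def topspace_pullback_topology)

lemma topspace_subtopology_weak_star:
  "S \<subseteq> Prob Y \<Longrightarrow> topspace (subtopology (weak_star Y) S) = S"
  by (auto simp: topspace_weak_star)

text \<open>The universal property of an initial topology. It reduces the continuity of
  \<open>G\<close>, \<open>E_star\<close> and \<open>push\<close> below to one test function at a
  time.\<close>

lemma continuous_map_into_weak_star:
  assumes "\<And>t. t \<in> topspace T \<Longrightarrow> g t \<in> Prob Y"
    and "\<And>f. f \<in> Cont Y \<Longrightarrow> continuous_map T euclideanreal (\<lambda>t. \<integral>x. f x \<partial>g t)"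
  shows "continuous_map T (weak_star Y) g"
  unfolding weak_star_def
proof (rule continuous_map_pullback')
  show "continuous_map T (product_topology (\<lambda>_. euclideanreal) (Cont Y))
      ((\<lambda>\<mu>. \<lambda>f\<in>Cont Y. \<integral>x. f x \<partial>\<mu>) \<circ> g)"
    unfolding continuous_map_componentwise using assms(2) by auto
qed (use assms(1) in auto)

lemma continuous_map_weak_star_integral:
  assumes "f \<in> Cont Y"
  shows "continuous_map (weak_star Y) euclideanreal (\<lambda>\<mu>. \<integral>x. f x \<partial>\<mu>)"
proof -
  have "continuous_map (weak_star Y) euclideanreal ((\<lambda>\<phi>. \<phi> f) \<circ> (\<lambda>\<mu>. \<lambda>f\<in>Cont Y. \<integral>x. f x \<partial>\<mu>))"
    unfolding weak_star_def
    by (intro continuous_map_pullback continuous_map_product_projection[OF assms])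
  with assms show ?thesis by (simp add: o_def)
qed

lemma closedin_Collect_Ball:
  assumes "\<And>i. i \<in> I \<Longrightarrow> closedin T {x \<in> topspace T. P i x}"
  shows "closedin T {x \<in> topspace T. \<forall>i\<in>I. P i x}"
proof -
  have "{x \<in> topspace T. \<forall>i\<in>I. P i x} = topspace T \<inter> (\<Inter>i\<in>I. {x \<in> topspace T. P i x})" by auto
  moreover have "closedin T (topspace T \<inter> (\<Inter>i\<in>I. {x \<in> topspace T. P i x}))"
    using assms by (cases "I = {}") (auto intro!: closedin_Int closedin_INT)
  ultimately show ?thesis by simp
qed

lemma closedin_Collect_real_eq:
  fixes F G :: "'b \<Rightarrow> real"
  assumes "continuous_map T euclideanreal F" "continuous_map T euclideanreal G"
  shows "closedin T {x \<in> topspace T. F x = G x}"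
proof -
  have "closedin T {x \<in> topspace T. F x - G x \<in> {0}}"
    by (rule closedin_continuous_map_preimage[OF continuous_map_diff[OF assms]]) simp
  then show ?thesis by simp
qed

lemma closedin_Collect_real_nonneg:
  fixes F :: "'b \<Rightarrow> real"
  assumes "continuous_map T euclideanreal F"
  shows "closedin T {x \<in> topspace T. 0 \<le> F x}"
proof -
  have "closedin T {x \<in> topspace T. F x \<in> {0..}}"
    by (rule closedin_continuous_map_preimage[OF assms]) simp
  then show ?thesis by simp
qed

lemma closedin_Collect_conj:
  assumes "closedin T {x \<in> topspace T. P x}" "closedin T {x \<in> topspace T. Q x}"
  shows "closedin T {x \<in> topspace T. P x \<and> Q x}"
proof -
  have "{x \<in> topspace T. P x \<and> Q x} = {x \<in> topspace T. P x} \<inter> {x \<in> topspace T. Q x}" by auto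
  with closedin_Int[OF assms] show ?thesis by simp
qed

lemma closedin_Collect_imp:
  "(C \<Longrightarrow> closedin T {x \<in> topspace T. P x}) \<Longrightarrow> closedin T {x \<in> topspace T. C \<longrightarrow> P x}"
  by (cases C) auto

text \<open>Each clause of \<open>state\<close> relates finitely many coordinates of L and so cuts
  out a closed set; the quantifiers become intersections.\<close>

lemma closedin_states:
  "closedin (product_topology (\<lambda>_. euclideanreal) (Cont Y))
     {L \<in> topspace (product_topology (\<lambda>_. euclideanreal) (Cont Y)). state Y L}"
proof -
  \<comment> \<open>The quantifier over the reals is put into the bounded form that
    \<open>closedin_Collect_Ball\<close> expects.\<close>
  have all: "{L \<in> topspace T. \<forall>c::real. Q c L} = {L \<in> topspace T. \<forall>c\<in>UNIV. Q c L}" for T Q by auto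
  have pr: "continuous_map (product_topology (\<lambda>_. euclideanreal) (Cont Y)) euclideanreal (\<lambda>L. L f)"
    if "f \<in> Cont Y" for f
    by (rule continuous_map_product_projection[OF that])
  show ?thesis
    unfolding state_def
    apply (intro closedin_Collect_conj)
    subgoal
      by (intro closedin_Collect_Ball closedin_Collect_real_eq continuous_map_add pr Cont_intros)
    subgoal unfolding all
      by (intro closedin_Collect_Ball closedin_Collect_real_eq continuous_map_real_mult_left pr Cont_intros)
    subgoal
      by (intro closedin_Collect_Ball closedin_Collect_imp closedin_Collect_real_nonneg pr)
    subgoal
      by (intro closedin_Collect_real_eq pr Cont_const) simp
    done
qed

section \<open>Compactness of the space of probability measures\<close>

context compact_second_countable
begin

text \<open>A state is squeezed between constants; consequently all states lie in one product of
  compact intervals.\<close>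

lemma state_bound:
  assumes "state Y L" "f \<in> Cont Y" "\<And>x. x \<in> topspace Y \<Longrightarrow> \<bar>f x\<bar> \<le> c"
  shows "L f \<in> {-c..c}"
proof -
  interpret state_on Y L by unfold_locales (rule assms(1))
  have "L f \<le> L (\<lambda>_. c)"
    using assms(3) by (intro mono assms Cont_const) (simp add: abs_le_iff)
  moreover have "L (\<lambda>_. -c) \<le> L f"
    using assms(3) by (intro mono assms Cont_const) (simp add: abs_le_iff minus_le_iff)
  ultimately show ?thesis by (simp add: const)
qed

lemma Hausdorff_weak_star: "Hausdorff_space (weak_star Y)"
  unfolding Hausdorff_space_def topspace_weak_star
proof (intro allI impI)
  fix \<mu> \<nu> assume "\<mu> \<in> Prob Y \<and> \<nu> \<in> Prob Y \<and> \<mu> \<noteq> \<nu>"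
  then have \<mu>: "\<mu> \<in> Prob Y" and \<nu>: "\<nu> \<in> Prob Y" and ne: "\<mu> \<noteq> \<nu>" by auto
  obtain f where f: "f \<in> Cont Y" and "(\<integral>x. f x \<partial>\<mu>) \<noteq> (\<integral>x. f x \<partial>\<nu>)"
    using Prob_eqI[OF \<mu> \<nu>] ne by blast
  from hausdorff[OF this(2)] obtain A B where AB: "open A" "open B"
    "(\<integral>x. f x \<partial>\<mu>) \<in> A" "(\<integral>x. f x \<partial>\<nu>) \<in> B" "A \<inter> B = {}" by metis
  have op: "openin (weak_star Y) {\<mu> \<in> Prob Y. (\<integral>x. f x \<partial>\<mu>) \<in> A}" if "open A" for A
    using openin_continuous_map_preimage[OF continuous_map_weak_star_integral[OF f]] that
    by (simp add: topspace_weak_star)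
  show "\<exists>U V. openin (weak_star Y) U \<and> openin (weak_star Y) V \<and> \<mu> \<in> U \<and> \<nu> \<in> V \<and> disjnt U V"
    by (intro exI[of _ "{\<mu> \<in> Prob Y. (\<integral>x. f x \<partial>\<mu>) \<in> A}"]
        exI[of _ "{\<mu> \<in> Prob Y. (\<integral>x. f x \<partial>\<mu>) \<in> B}"])
      (use AB \<mu> \<nu> op in \<open>auto simp: disjnt_def\<close>)
qed

text \<open>Banach-Alaoglu followed by Riesz. The states in a product of intervals form a compact
  set by Tychonoff and \<open>closedin_states\<close>; the representing measure depends continuously
  on the state because its integrals are the coordinates, and every probability measure arises in
  this way.\<close>

lemma compact_weak_star: "compact_space (weak_star Y)"
proof -
  let ?P = "product_topology (\<lambda>_. euclideanreal) (Cont Y)"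
  have "\<forall>f\<in>Cont Y. \<exists>c. \<forall>x\<in>topspace Y. \<bar>f x\<bar> \<le> c"
  proof
    fix f assume "f \<in> Cont Y"
    then show "\<exists>c. \<forall>x\<in>topspace Y. \<bar>f x\<bar> \<le> c" by (rule Cont_bounded) (rule exI, rule ballI)
  qed
  from bchoice[OF this] obtain c where c: "\<forall>f\<in>Cont Y. \<forall>x\<in>topspace Y. \<bar>f x\<bar> \<le> c f" ..
  define K where "K = (PiE (Cont Y) (\<lambda>f. {- c f..c f})) \<inter> {L \<in> topspace ?P. state Y L}"
  have "compactin ?P (PiE (Cont Y) (\<lambda>f. {- c f..c f}))" by (simp add: compactin_PiE)
  then have K: "compactin ?P K"
    unfolding K_def by (rule compact_Int_closedin) (rule closedin_states)
  define G where "G = (\<lambda>L. THE \<nu>. \<nu> \<in> Prob Y \<and> (\<forall>f\<in>Cont Y. (\<integral>x. f x \<partial>\<nu>) = L f))"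
  have G: "G L \<in> Prob Y \<and> (\<forall>f\<in>Cont Y. (\<integral>x. f x \<partial>(G L)) = L f)" if "L \<in> K" for L
  proof -
    have "state Y L" using that by (simp add: K_def)
    from theI'[OF riesz_representation[OF this]] show ?thesis unfolding G_def .
  qed
  have top: "topspace (subtopology ?P K) = K" by (auto simp: K_def)
  have "continuous_map (subtopology ?P K) (weak_star Y) G"
  proof (rule continuous_map_into_weak_star)
    fix f assume f: "f \<in> Cont Y"
    have "continuous_map (subtopology ?P K) euclideanreal (\<lambda>L. L f)"
      by (intro continuous_map_from_subtopology continuous_map_product_projection f)
    then show "continuous_map (subtopology ?P K) euclideanreal (\<lambda>L. \<integral>x. f x \<partial>(G L))"
      by (rule continuous_map_eq) (use G f top in auto)
  qed (use G top in auto)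
  moreover have "compactin (subtopology ?P K) K" using K by (simp add: compactin_subtopology)
  ultimately have "compactin (weak_star Y) (G ` K)" by (rule image_compactin[rotated])
  moreover have "G ` K = Prob Y"
  proof
    show "G ` K \<subseteq> Prob Y" using G by auto
    show "Prob Y \<subseteq> G ` K"
    proof
      fix \<mu> assume \<mu>: "\<mu> \<in> Prob Y"
      \<comment> \<open>Points of the product are extensional on \<open>Cont Y\<close>, hence the
        restriction; it does no harm, as \<open>state\<close> reads L only there.\<close>
      define L where "L = (\<lambda>f\<in>Cont Y. \<integral>x. f x \<partial>\<mu>)"
      have "state Y L"
        using state_integral[OF \<mu>] unfolding L_def state_def
        by (simp add: Cont_intros)
      moreover from this have "L f \<in> {- c f..c f}" if "f \<in> Cont Y" for f
        by (rule state_bound[OF _ that]) (rule c[rule_format, OF that])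
      ultimately have L: "L \<in> K" by (simp add: K_def PiE_iff L_def)
      have "G L = \<mu>" using G[OF L] by (intro Prob_eqI \<mu>) (auto simp: L_def)
      with L show "\<mu> \<in> G ` K" by blast
    qed
  qed
  ultimately show ?thesis by (simp add: compact_space_def topspace_weak_star)
qed

end

section \<open>Integration against convex combinations\<close>

lemma space_mix: "space (mix t \<mu> \<nu>) = space \<mu>"
  by (rule sets_eq_imp_space_eq) (rule sets_mix)

text \<open>\<open>mix\<close> is given by its values on sets, so linearity in the measure is
  obtained by induction on the integrand.\<close>

lemma nn_integral_mix:
  assumes s: "sets \<nu> = sets \<mu>" and f: "f \<in> borel_measurable \<mu>"
  shows "(\<integral>\<^sup>+x. f x \<partial>mix t \<mu> \<nu>) = ennreal (1 - t) * (\<integral>\<^sup>+x. f x \<partial>\<mu>) + ennreal t * (\<integral>\<^sup>+x. f x \<partial>\<nu>)"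
  using f
proof induction
  have meas: "g \<in> borel_measurable (mix t \<mu> \<nu>)" "g \<in> borel_measurable \<nu>"
    if "g \<in> borel_measurable \<mu>" for g :: "'a \<Rightarrow> ennreal"
    using that measurable_cong_sets[OF sets_mix refl] measurable_cong_sets[OF s refl] by blast+
  {
    case (cong f g)
    have "(\<integral>\<^sup>+x. f x \<partial>M) = (\<integral>\<^sup>+x. g x \<partial>M)" if "space M = space \<mu>" for M
      by (rule nn_integral_cong) (use cong that in auto)
    with cong show ?case using space_mix sets_eq_imp_space_eq[OF s] by metis
  next
    case (set A)
    with s show ?case by (simp add: emeasure_mix sets_mix)
  next
    case (mult u v)
    then show ?case by (simp add: nn_integral_cmult meas ring_distribs mult.left_commute)
  next
    case (add u v)
    then show ?case by (simp add: nn_integral_add meas ring_distribs ac_simps)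
  next
    case (seq U)
    have "(\<integral>\<^sup>+x. (SUP i. U i) x \<partial>M) = (SUP i. \<integral>\<^sup>+x. U i x \<partial>M)" if "\<And>i. U i \<in> borel_measurable M" for M
      unfolding SUP_apply by (intro nn_integral_monotone_convergence_SUP that seq)
    moreover have "incseq (\<lambda>i. c * (\<integral>\<^sup>+x. U i x \<partial>M))" for c M
      using seq(3) by (auto simp: incseq_def le_fun_def intro!: mult_left_mono nn_integral_mono)
    ultimately show ?case
      using seq by (simp add: meas SUP_mult_left_ennreal ennreal_SUP_add)
  }
qed

lemma mix_Prob:
  assumes "\<mu> \<in> Prob Y" "\<nu> \<in> Prob Y" "t \<in> {0..1}"
  shows "mix t \<mu> \<nu> \<in> Prob Y"
proof -
  have "sets \<nu> = sets \<mu>" using assms by (simp add: Prob_sets)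
  moreover from this have "space \<nu> = space \<mu>" by (rule sets_eq_imp_space_eq)
  ultimately show ?thesis
    using assms emeasure_mix[of \<nu> \<mu> "space \<mu>" t]
    by (auto simp: Prob_def sets_mix space_mix simp flip: ennreal_plus)
qed

lemma (in compact_second_countable) integral_mix:
  assumes \<mu>: "\<mu> \<in> Prob Y" and \<nu>: "\<nu> \<in> Prob Y" and t: "t \<in> {0..1}" and f: "f \<in> Cont Y"
  shows "(\<integral>x. f x \<partial>mix t \<mu> \<nu>) = (1 - t) * (\<integral>x. f x \<partial>\<mu>) + t * (\<integral>x. f x \<partial>\<nu>)"
proof -
  have s: "sets \<nu> = sets \<mu>" using \<mu> \<nu> by (simp add: Prob_sets)
  \<comment> \<open>Finite positive and negative parts let \<open>enn2real\<close> commute with the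
    sum of the two integrals.\<close>
  have fin: "(\<integral>\<^sup>+x. ennreal (f x) \<partial>M) < top" "(\<integral>\<^sup>+x. ennreal (- f x) \<partial>M) < top" if "M \<in> Prob Y" for M
    using integrableD(2,3)[OF integrable_Cont[OF that f]] by (simp_all add: less_top)
  have meas: "f \<in> borel_measurable \<mu>" by (rule Prob_measurable[OF \<mu> f])
  show ?thesis
    using t fin[OF \<mu>] fin[OF \<nu>] s meas
    unfolding real_lebesgue_integral_def[OF integrable_Cont[OF \<mu> f]]
      real_lebesgue_integral_def[OF integrable_Cont[OF \<nu> f]]
      real_lebesgue_integral_def[OF integrable_Cont[OF mix_Prob[OF \<mu> \<nu> t] f]]
    by (simp add: nn_integral_mix enn2real_plus enn2real_mult ennreal_mult_less_top algebra_simps)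
qed

lemma (in compact_second_countable) compact_convex_weak_star: "compact_convex (weak_star Y) mix"
  by (simp add: compact_convex_def compact_weak_star Hausdorff_weak_star topspace_weak_star mix_Prob)

section \<open>Sums over fibres\<close>

text \<open>All that fibre sums need from a local homeomorphism; unlike the latter, this is also easy to
  verify for the projection \<open>R\<^sub>n \<rightarrow> X\<close>.\<close>

definition locally_injective_open_map :: "'a topology \<Rightarrow> 'b topology \<Rightarrow> ('a \<Rightarrow> 'b) \<Rightarrow> bool" where
  "locally_injective_open_map Y Z q \<longleftrightarrow> continuous_map Y Z q \<and> open_map Y Z q \<and>
     (\<forall>x\<in>topspace Y. \<exists>U. openin Y U \<and> x \<in> U \<and> inj_on q U)"

text \<open>Openness is local: the image of W is the union of the images of its intersections with
  the \<open>U x\<close>, each of which is open in the open image of \<open>U x\<close>.\<close>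

lemma local_homeomorphism_locally_injective_open_map:
  assumes "local_homeomorphism Y Z q"
  shows "locally_injective_open_map Y Z q"
proof -
  have q: "continuous_map Y Z q" using assms by (simp add: local_homeomorphism_def)
  have "\<forall>x\<in>topspace Y. \<exists>U. openin Y U \<and> x \<in> U \<and> openin Z (q ` U) \<and>
      homeomorphic_map (subtopology Y U) (subtopology Z (q ` U)) q"
    using assms by (simp add: local_homeomorphism_def)
  from bchoice[OF this] obtain U where U: "\<forall>x\<in>topspace Y. openin Y (U x) \<and> x \<in> U x \<and> openin Z (q ` U x) \<and>
      homeomorphic_map (subtopology Y (U x)) (subtopology Z (q ` U x)) q" ..
  have inj: "inj_on q (U x)" if x: "x \<in> topspace Y" for x
  proof -
    have "topspace (subtopology Y (U x)) = U x"
      using U x openin_subset by (metis inf.absorb2 topspace_subtopology)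
    with U x show ?thesis by (metis homeomorphic_imp_injective_map)
  qed
  have "open_map Y Z q"
    unfolding open_map_def
  proof (intro allI impI)
    fix W assume W: "openin Y W"
    have loc: "openin Z (q ` (W \<inter> U x))" if x: "x \<in> W" for x
    proof -
      have x': "x \<in> topspace Y" using x W openin_subset by blast
      then have Ux: "openin Y (U x)" "openin Z (q ` U x)"
        "open_map (subtopology Y (U x)) (subtopology Z (q ` U x)) q"
        using U by (simp_all add: homeomorphic_imp_open_map)
      have "openin (subtopology Y (U x)) (W \<inter> U x)"
        using W by (rule openin_subtopology_Int)
      then have "openin (subtopology Z (q ` U x)) (q ` (W \<inter> U x))"
        using Ux(3) by (simp add: open_map_def)
      with Ux(2) show ?thesis by (simp add: openin_open_subtopology)
    qed
    have "x \<in> U x" if "x \<in> W" for x using that U W openin_subset by blast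
    then have "q ` W = \<Union>((\<lambda>x. q ` (W \<inter> U x)) ` W)" by blast
    moreover have "openin Z (\<Union>((\<lambda>x. q ` (W \<inter> U x)) ` W))" by (rule openin_Union) (use loc in blast)
    ultimately show "openin Z (q ` W)" by (simp only:)
  qed
  with q inj U show ?thesis unfolding locally_injective_open_map_def by blast
qed

lemma locally_injective_open_map_id: "locally_injective_open_map Y Y id"
  unfolding locally_injective_open_map_def
  by (auto simp: open_map_def intro!: exI[of _ "topspace Y"])

lemma locally_injective_open_map_compose:
  assumes q: "locally_injective_open_map X Y q" and r: "locally_injective_open_map Y Z r"
  shows "locally_injective_open_map X Z (r \<circ> q)"
  unfolding locally_injective_open_map_def
proof (intro conjI ballI)
  have qc: "continuous_map X Y q" using q by (simp add: locally_injective_open_map_def)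
  show "continuous_map X Z (r \<circ> q)" "open_map X Z (r \<circ> q)"
    using q r by (auto simp: locally_injective_open_map_def intro: continuous_map_compose open_map_compose)
  fix x assume x: "x \<in> topspace X"
  then have qx: "q x \<in> topspace Y" using qc continuous_map_image_subset_topspace by blast
  obtain U where U: "openin X U" "x \<in> U" "inj_on q U"
    using q x unfolding locally_injective_open_map_def by metis
  obtain V where V: "openin Y V" "q x \<in> V" "inj_on r V"
    using r qx unfolding locally_injective_open_map_def by metis
  have "openin X (U \<inter> {x \<in> topspace X. q x \<in> V})"
    using U V qc by (intro openin_Int openin_continuous_map_preimage)
  moreover have "inj_on (r \<circ> q) (U \<inter> {x \<in> topspace X. q x \<in> V})"
    using U(3) V(3) by (auto simp: inj_on_def)
  ultimately show "\<exists>U. openin X U \<and> x \<in> U \<and> inj_on (r \<circ> q) U"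
    using x U V by blast
qed

text \<open>A fibre is closed, hence compact, and a neighbourhood on which \<open>q\<close> is
  injective contains at most one of its points; a finite subcover therefore bounds their
  number.\<close>

lemma finite_fibre:
  assumes q: "locally_injective_open_map Y Z q" and Y: "compact_space Y" and Z: "Hausdorff_space Z"
  shows "finite {x \<in> topspace Y. q x = \<omega>}"
proof (cases "\<omega> \<in> topspace Z")
  case True
  let ?F = "{x \<in> topspace Y. q x = \<omega>}"
  have qc: "continuous_map Y Z q" using q by (simp add: locally_injective_open_map_def)
  have "closedin Z {\<omega>}" using Z True by (simp add: closedin_Hausdorff_singleton)
  from closedin_continuous_map_preimage[OF qc this] have cF: "compactin Y ?F"
    using Y by (simp add: closedin_compact_space)
  have "\<forall>x\<in>topspace Y. \<exists>U. openin Y U \<and> x \<in> U \<and> inj_on q U"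
    using q by (simp add: locally_injective_open_map_def)
  from bchoice[OF this] obtain U where U: "\<forall>x\<in>topspace Y. openin Y (U x) \<and> x \<in> U x \<and> inj_on q (U x)" ..
  have "\<exists>\<F>. finite \<F> \<and> \<F> \<subseteq> U ` ?F \<and> ?F \<subseteq> \<Union>\<F>"
    by (rule compactinD[OF cF]) (use U in auto)
  then obtain \<F> where F: "finite \<F> \<and> \<F> \<subseteq> U ` ?F \<and> ?F \<subseteq> \<Union>\<F>" ..
  then have "\<exists>G\<subseteq>?F. finite G \<and> \<F> = U ` G" by (intro finite_subset_image) simp_all
  then obtain G where G: "G \<subseteq> ?F" "finite G" "\<F> = U ` G" by (elim exE conjE) (rule that)
  have "?F \<subseteq> G"
  proof
    fix x assume x: "x \<in> ?F"
    then obtain y where y: "y \<in> G" "x \<in> U y" using F G by blast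
    then have "y \<in> topspace Y" "q y = q x" using G x by auto
    then have "inj_on q (U y)" "y \<in> U y" using U by auto
    with \<open>q y = q x\<close> y(2) have "x = y" by (auto dest: inj_onD)
    with y show "x \<in> G" by simp
  qed
  with G show ?thesis by (rule_tac finite_subset)
next
  case False
  then have "{x \<in> topspace Y. q x = \<omega>} = {}"
    using q continuous_map_image_subset_topspace unfolding locally_injective_open_map_def by blast
  then show ?thesis by (simp only: finite.emptyI)
qed

lemma Hausdorff_finite_separation:
  assumes Y: "Hausdorff_space Y" and S: "finite S" "S \<subseteq> topspace Y"
  obtains U where "\<And>x. x \<in> S \<Longrightarrow> openin Y (U x)" "\<And>x. x \<in> S \<Longrightarrow> x \<in> U x"
    "\<And>x y. x \<in> S \<Longrightarrow> y \<in> S \<Longrightarrow> x \<noteq> y \<Longrightarrow> U x \<inter> U y = {}"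
proof -
  have "\<forall>z\<in>{(x, y) \<in> S \<times> S. x \<noteq> y}. \<exists>w. openin Y (fst w) \<and> openin Y (snd w) \<and>
      fst z \<in> fst w \<and> snd z \<in> snd w \<and> disjnt (fst w) (snd w)"
  proof
    fix z assume "z \<in> {(x, y) \<in> S \<times> S. x \<noteq> y}"
    then have "fst z \<in> topspace Y \<and> snd z \<in> topspace Y \<and> fst z \<noteq> snd z" using S by auto
    then obtain A B where "openin Y A \<and> openin Y B \<and> fst z \<in> A \<and> snd z \<in> B \<and> disjnt A B"
      using Y unfolding Hausdorff_space_def by metis
    then show "\<exists>w. openin Y (fst w) \<and> openin Y (snd w) \<and>
      fst z \<in> fst w \<and> snd z \<in> snd w \<and> disjnt (fst w) (snd w)" by (intro exI[of _ "(A, B)"]) simp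
  qed
  from bchoice[OF this] obtain P where
    P: "\<forall>z\<in>{(x, y) \<in> S \<times> S. x \<noteq> y}. openin Y (fst (P z)) \<and> openin Y (snd (P z)) \<and>
      fst z \<in> fst (P z) \<and> snd z \<in> snd (P z) \<and> disjnt (fst (P z)) (snd (P z))" ..
  \<comment> \<open>The choices made for (x,y) and (y,x) are unrelated; intersecting the two
    neighbourhoods of x makes the separation symmetric.\<close>
  define A where "A = (\<lambda>x y. fst (P (x, y)) \<inter> snd (P (y, x)))"
  have A: "openin Y (A x y)" "x \<in> A x y" "A x y \<inter> A y x = {}" if "x \<in> S" "y \<in> S" "x \<noteq> y" for x y
    using P[rule_format, of "(x, y)"] P[rule_format, of "(y, x)"] that
    by (auto simp: A_def disjnt_def)
  show thesis
  proof
    fix x assume x: "x \<in> S"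
    show "openin Y (topspace Y \<inter> \<Inter>(A x ` (S - {x})))"
      using S x A(1) by (intro openin_Int_Inter) auto
    show "x \<in> topspace Y \<inter> \<Inter>(A x ` (S - {x}))" using S x A(2) by auto
    fix y assume "y \<in> S" "x \<noteq> y"
    with x A(3)[of x y] show "(topspace Y \<inter> \<Inter>(A x ` (S - {x}))) \<inter> (topspace Y \<inter> \<Inter>(A y ` (S - {y}))) = {}"
      by blast
  qed
qed

text \<open>Fibres over nearby points correspond bijectively: small disjoint neighbourhoods of the
  points over \<omega> each contribute exactly one point over \<omega>', with nearly the same value
  of f. Openness of q provides these points, local injectivity makes them unique, and closedness of
  q, a consequence of compactness, excludes others.\<close>

lemma continuous_map_fibre_sum:
  fixes f :: "'a \<Rightarrow> real"
  assumes q: "locally_injective_open_map Y Z q" and Y: "compact_space Y" "Hausdorff_space Y"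
    and Z: "Hausdorff_space Z" and f: "continuous_map Y euclideanreal f"
  shows "continuous_map Z euclideanreal (\<lambda>\<omega>. \<Sum>x\<in>{x \<in> topspace Y. q x = \<omega>}. f x)"
proof -
  have qc: "continuous_map Y Z q" and qo: "open_map Y Z q"
    and qi: "\<forall>x\<in>topspace Y. \<exists>U. openin Y U \<and> x \<in> U \<and> inj_on q U"
    using q by (simp_all add: locally_injective_open_map_def)
  have qcl: "closed_map Y Z q" by (rule continuous_imp_closed_map[OF qc Y(1) Z])
  let ?F = "\<lambda>\<omega>. {x \<in> topspace Y. q x = \<omega>}"
  have loc: "\<exists>V. openin Z V \<and> \<omega> \<in> V \<and> (\<forall>\<omega>'\<in>V. \<bar>sum f (?F \<omega>) - sum f (?F \<omega>')\<bar> < e)"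
    if \<omega>: "\<omega> \<in> topspace Z" and e: "0 < e" for \<omega> e
  proof -
    have S: "finite (?F \<omega>)" "?F \<omega> \<subseteq> topspace Y" using finite_fibre[OF q Y(1) Z] by auto
    obtain A where A: "\<And>x. x \<in> ?F \<omega> \<Longrightarrow> openin Y (A x)" "\<And>x. x \<in> ?F \<omega> \<Longrightarrow> x \<in> A x"
      "\<And>x y. x \<in> ?F \<omega> \<Longrightarrow> y \<in> ?F \<omega> \<Longrightarrow> x \<noteq> y \<Longrightarrow> A x \<inter> A y = {}"
      by (rule Hausdorff_finite_separation[OF Y(2) S]) (rule that; assumption)
    from bchoice[OF qi] obtain B where B: "\<forall>x\<in>topspace Y. openin Y (B x) \<and> x \<in> B x \<and> inj_on q (B x)" ..
    \<comment> \<open>The added 1 allows for an empty fibre and makes the final bound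
      strict.\<close>
    define d where "d = e / (real (card (?F \<omega>)) + 1)"
    have d: "0 < d" "real (card (?F \<omega>)) * d < e" using e by (auto simp: d_def field_simps)
    define U where "U = (\<lambda>x. A x \<inter> B x \<inter> {y \<in> topspace Y. f y \<in> ball (f x) d})"
    have U: "openin Y (U x)" "x \<in> U x" "inj_on q (U x)" "\<And>y. y \<in> U x \<Longrightarrow> \<bar>f x - f y\<bar> < d"
      if "x \<in> ?F \<omega>" for x
    proof -
      have "openin Y {y \<in> topspace Y. f y \<in> ball (f x) d}"
        by (rule openin_continuous_map_preimage[OF f]) simp
      then show "openin Y (U x)" unfolding U_def using A B that by (intro openin_Int) auto
      show "x \<in> U x" "inj_on q (U x)" "\<And>y. y \<in> U x \<Longrightarrow> \<bar>f x - f y\<bar> < d"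
        using A(2)[OF that] B that d(1) by (auto simp: U_def dist_real_def intro: inj_on_subset)
    qed
    have disj: "x = y" if "x \<in> ?F \<omega>" "y \<in> ?F \<omega>" "z \<in> U x" "z \<in> U y" for x y z
      using A(3)[OF that(1,2)] that(3,4) by (auto simp: U_def)
    \<comment> \<open>The images of the \<open>U x\<close> guarantee a point over \<omega>' near
      each x. Removing the image of the rest of Y guarantees that no point over \<omega>' lies
      elsewhere.\<close>
    define V where "V = \<Inter>(insert (topspace Z - q ` (topspace Y - \<Union>(U ` ?F \<omega>))) ((\<lambda>x. q ` U x) ` ?F \<omega>))"
    have "openin Y (\<Union>(U ` ?F \<omega>))" using U(1) by (intro openin_Union) blast
    then have "closedin Z (q ` (topspace Y - \<Union>(U ` ?F \<omega>)))"
      using qcl unfolding closed_map_def by blast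
    then have "openin Z V"
      unfolding V_def using S(1) U(1) qo by (intro openin_Inter) (auto simp: open_map_def)
    moreover have "\<omega> \<in> V"
      unfolding V_def using U(2) \<omega> by auto
    moreover have "\<bar>sum f (?F \<omega>) - sum f (?F \<omega>')\<bar> < e" if \<omega>': "\<omega>' \<in> V" for \<omega>'
    proof -
      have "\<forall>x\<in>?F \<omega>. \<exists>y. y \<in> U x \<and> q y = \<omega>'" using \<omega>' by (auto simp: V_def)
      from bchoice[OF this] obtain s where s: "\<forall>x\<in>?F \<omega>. s x \<in> U x \<and> q (s x) = \<omega>'" ..
      have "bij_betw s (?F \<omega>) (?F \<omega>')"
        unfolding bij_betw_def
      proof
        show "inj_on s (?F \<omega>)"
        proof (rule inj_onI)
          fix x y assume xy: "x \<in> ?F \<omega>" "y \<in> ?F \<omega>" "s x = s y"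
          have "s x \<in> U x" "s y \<in> U y"
            using bspec[OF s xy(1)] bspec[OF s xy(2)] by simp_all
          then show "x = y" using disj[OF xy(1,2), of "s x"] xy(3) by simp
        qed
        show "s ` ?F \<omega> = ?F \<omega>'"
        proof
          show "s ` ?F \<omega> \<subseteq> ?F \<omega>'"
          proof (rule image_subsetI)
            fix x assume x: "x \<in> ?F \<omega>"
            with s have "s x \<in> U x" "q (s x) = \<omega>'" by auto
            with openin_subset[OF U(1)[OF x]] show "s x \<in> ?F \<omega>'" by auto
          qed
          show "?F \<omega>' \<subseteq> s ` ?F \<omega>"
          proof
            fix y assume y: "y \<in> ?F \<omega>'"
            then obtain x where x: "x \<in> ?F \<omega>" "y \<in> U x" using \<omega>' by (auto simp: V_def)
            with s y have "s x \<in> U x" "q (s x) = q y" by auto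
            from inj_onD[OF U(3)[OF x(1)] this(2,1) x(2)] have "s x = y" .
            with x(1) show "y \<in> s ` ?F \<omega>" by blast
          qed
        qed
      qed
      then have "sum f (?F \<omega>') = (\<Sum>x\<in>?F \<omega>. f (s x))" by (simp add: sum.reindex_bij_betw)
      then have "\<bar>sum f (?F \<omega>) - sum f (?F \<omega>')\<bar> = \<bar>\<Sum>x\<in>?F \<omega>. f x - f (s x)\<bar>"
        by (simp add: sum_subtractf)
      also have "\<dots> \<le> (\<Sum>x\<in>?F \<omega>. \<bar>f x - f (s x)\<bar>)" by (rule sum_abs)
      also have "\<dots> \<le> (\<Sum>x\<in>?F \<omega>. d)"
        by (rule sum_mono) (use U(4) s in \<open>auto intro: less_imp_le\<close>)
      also have "\<dots> < e" using d(2) by simp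
      finally show ?thesis .
    qed
    ultimately show ?thesis by blast
  qed
  have "continuous_map Z Met_TC.mtopology (\<lambda>\<omega>. sum f (?F \<omega>))"
    unfolding Met_TC.continuous_map_to_metric using loc by (simp add: dist_real_def)
  then show ?thesis by simp
qed

section \<open>Potentials and expectations of an AP equivalence relation\<close>

locale AP_cocycle =
  fixes X :: "nat \<Rightarrow> 'a topology" and p :: "nat \<Rightarrow> 'a \<Rightarrow> 'a" and D :: "'a \<times> 'a \<Rightarrow> real"
  assumes AP: "AP_sequence X p" and cocycle: "D \<in> cocycles (R_top X p)"
begin

abbreviation "\<Omega> \<equiv> topspace (X 0)"
abbreviation "\<pi> \<equiv> proj p"
abbreviation "R \<equiv> Rn X p"
abbreviation "T \<equiv> Rn_top X p"
abbreviation "\<rho> \<equiv> rho X p D"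
abbreviation "E \<equiv> En X p D"
abbreviation "P \<equiv> Pn X p D"
abbreviation fibre :: "nat \<Rightarrow> 'a \<Rightarrow> 'a set" where
  "fibre n \<omega> \<equiv> {x \<in> \<Omega>. \<pi> n x = \<omega>}"

lemma compact_X0: "compact_space (X 0)" and Hausdorff_X: "Hausdorff_space (X n)"
  using AP by (simp_all add: AP_sequence_def)

lemma step_map: "locally_injective_open_map (X n) (X (Suc n)) (p n)"
  using AP by (simp add: AP_sequence_def local_homeomorphism_locally_injective_open_map)

lemma step_surj: "p n ` topspace (X n) = topspace (X (Suc n))"
  using AP by (simp add: AP_sequence_def)

lemma proj_map: "locally_injective_open_map (X 0) (X n) (\<pi> n)"
proof (induction n)
  case 0 show ?case unfolding proj.simps by (rule locally_injective_open_map_id)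
next
  case (Suc n)
  from locally_injective_open_map_compose[OF this step_map] show ?case unfolding proj.simps .
qed

lemma proj_continuous: "continuous_map (X 0) (X n) (\<pi> n)"
  using proj_map by (simp add: locally_injective_open_map_def)

lemma proj_surj: "\<pi> n ` \<Omega> = topspace (X n)"
proof (induction n)
  case (Suc n)
  then show ?case by (simp only: proj.simps image_comp[symmetric] step_surj)
qed simp

lemma proj_in: "x \<in> \<Omega> \<Longrightarrow> \<pi> n x \<in> topspace (X n)"
  using proj_surj by blast

text \<open>Compactness and second countability descend from X_0 along the continuous open
  surjection \<pi>_n.\<close>

lemma compact_second_countable: "compact_second_countable (X n)"
proof
  have "compactin (X n) (\<pi> n ` \<Omega>)"
    using compact_X0 proj_continuous unfolding compact_space_def by (rule image_compactin)
  then show "compact_space (X n)" by (simp add: compact_space_def proj_surj)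
  have "second_countable (X 0)" using AP by (simp add: AP_sequence_def)
  then show "second_countable (X n)"
    using proj_map[of n] proj_surj[of n]
    by (intro second_countable_open_map_image[of "X 0" "X n" "\<pi> n"])
      (simp_all add: locally_injective_open_map_def)
qed (rule Hausdorff_X)

lemma compact_X: "compact_space (X n)"
  by (rule compact_second_countable.compact_Y[OF compact_second_countable])

lemma finite_fibre_proj: "finite (fibre n \<omega>)"
  by (rule finite_fibre[OF proj_map compact_X0 Hausdorff_X])

lemma finite_fibre_step: "finite {z \<in> topspace (X n). p n z = \<omega>}"
  by (rule finite_fibre[OF step_map compact_X Hausdorff_X])

section \<open>The relations R_n as compact spaces over X\<close>

lemma Rn_iff: "(x, y) \<in> R n \<longleftrightarrow> x \<in> \<Omega> \<and> y \<in> \<Omega> \<and> \<pi> n x = \<pi> n y"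
  by (simp add: Rn_def)

lemma Rn_Suc: "R n \<subseteq> R (Suc n)"
  by (auto simp: Rn_def)

lemma Rn_mono: "m \<le> n \<Longrightarrow> R m \<subseteq> R n"
  by (rule lift_Suc_mono_le[of R, OF Rn_Suc])

lemma class_eq_fibre: "x \<in> \<Omega> \<Longrightarrow> {y. (x, y) \<in> R n} = fibre n (\<pi> n x)"
  "x \<in> \<Omega> \<Longrightarrow> {y. (y, x) \<in> R n} = fibre n (\<pi> n x)"
  by (auto simp: Rn_iff)

lemma finite_class: "finite {y. (x, y) \<in> R n}" "finite {y. (y, x) \<in> R n}"
  by (rule finite_subset[OF _ finite_fibre_proj[of n "\<pi> n x"]]; auto simp: Rn_iff)+

text \<open>R_n is where \<pi>_n after the first projection equals \<pi>_n after the second, and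
  this is closed because X_n is Hausdorff.\<close>

lemma compact_Rn_top: "compact_space (T n)" and Hausdorff_Rn_top: "Hausdorff_space (T n)"
  and closedin_Rn: "closedin (prod_topology (X 0) (X 0)) (R n)"
proof -
  let ?P = "prod_topology (X 0) (X 0)"
  have "closedin ?P {z \<in> topspace ?P. (\<pi> n \<circ> fst) z = (\<pi> n \<circ> snd) z}"
    by (rule closedin_continuous_maps_eq[OF Hausdorff_X continuous_map_compose[OF continuous_map_fst proj_continuous]
        continuous_map_compose[OF continuous_map_snd proj_continuous]])
  moreover have "{z \<in> topspace ?P. (\<pi> n \<circ> fst) z = (\<pi> n \<circ> snd) z} = R n"
    by (auto simp: Rn_def)
  ultimately show c: "closedin ?P (R n)" by simp
  have "compact_space ?P" using compact_X0 by (simp add: compact_space_prod_topology)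
  then have "compactin ?P (R n)" using c by (rule closedin_compact_space)
  then show "compact_space (T n)" unfolding Rn_top_def by (rule compact_space_subtopology)
  have "Hausdorff_space ?P" using Hausdorff_X by (simp add: Hausdorff_space_prod_topology)
  then show "Hausdorff_space (T n)" unfolding Rn_top_def by (rule Hausdorff_space_subtopology)
qed

lemma continuous_fst: "continuous_map (T n) (X 0) fst" and continuous_snd: "continuous_map (T n) (X 0) snd"
  unfolding Rn_top_def by (intro continuous_map_from_subtopology continuous_map_fst continuous_map_snd)+

lemma continuous_swap: "continuous_map (T n) (T n) prod.swap"
proof -
  have "continuous_map (T n) (prod_topology (X 0) (X 0)) (\<lambda>z. (snd z, fst z))"
    by (intro continuous_map_pairedI continuous_fst continuous_snd)
  moreover have "(\<lambda>z. (snd z, fst z)) = (prod.swap :: 'a \<times> 'a \<Rightarrow> 'a \<times> 'a)" by (auto simp: fun_eq_iff)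
  ultimately have "continuous_map (T n) (prod_topology (X 0) (X 0)) prod.swap" by simp
  moreover have "prod.swap \<in> topspace (T n) \<rightarrow> R n"
    by (auto simp: topspace_Rn_top Rn_def)
  ultimately have "continuous_map (T n) (subtopology (prod_topology (X 0) (X 0)) (R n)) prod.swap"
    by (rule continuous_map_into_subtopology)
  then show ?thesis by (simp only: Rn_top_def)
qed

text \<open>If W contains all pairs of R_n in a rectangle with sides A and B, it has a pair over
  each point of A whose \<pi>_n-image lies in that of B. These points form an open set as \<pi>_n is
  open, so \<open>fst\<close> is open. Where \<pi>_n is injective on the second coordinates, the
  first coordinate determines the second.\<close>

lemma fst_map: "locally_injective_open_map (T n) (X 0) fst"
  unfolding locally_injective_open_map_def
proof (intro conjI ballI)
  show "continuous_map (T n) (X 0) fst" by (rule continuous_fst)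
  have pc: "continuous_map (X 0) (X n) (\<pi> n)" and po: "open_map (X 0) (X n) (\<pi> n)"
    using proj_map by (simp_all add: locally_injective_open_map_def)
  show "open_map (T n) (X 0) fst"
    unfolding open_map_def
  proof (intro allI impI)
    fix W assume "openin (T n) W"
    then obtain W' where W': "openin (prod_topology (X 0) (X 0)) W'" "W = W' \<inter> R n"
      unfolding Rn_top_def openin_subtopology by (elim exE conjE) (rule that)
    have "\<exists>V. openin (X 0) V \<and> x \<in> V \<and> V \<subseteq> fst ` W" if x: "x \<in> fst ` W" for x
    proof -
      obtain y where y: "(x, y) \<in> W" using x by force
      then have "(x, y) \<in> W'" by (simp add: W'(2))
      from W'(1)[unfolded openin_prod_topology_alt, rule_format, OF this]
      obtain A B where AB: "openin (X 0) A" "openin (X 0) B" "x \<in> A" "y \<in> B" "A \<times> B \<subseteq> W'"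
        by (elim exE conjE) (rule that)
      let ?V = "A \<inter> {x' \<in> \<Omega>. \<pi> n x' \<in> \<pi> n ` B}"
      have "openin (X n) (\<pi> n ` B)" using po AB(2) by (simp add: open_map_def)
      then have "openin (X 0) ?V" by (intro openin_Int AB(1) openin_continuous_map_preimage[OF pc])
      moreover have "x \<in> ?V" using y AB by (auto simp: W'(2) Rn_iff)
      moreover have "?V \<subseteq> fst ` W"
      proof
        fix x' assume "x' \<in> ?V"
        then obtain y' where y': "x' \<in> A" "x' \<in> \<Omega>" "y' \<in> B" "\<pi> n x' = \<pi> n y'" by auto
        moreover have "y' \<in> \<Omega>" using y'(3) openin_subset[OF AB(2)] by blast
        ultimately have "(x', y') \<in> W" using AB(5) by (auto simp: W'(2) Rn_iff)
        then show "x' \<in> fst ` W" by (rule image_eqI[rotated]) simp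
      qed
      ultimately show ?thesis by (intro exI[of _ ?V] conjI)
    qed
    then show "openin (X 0) (fst ` W)" by (subst openin_subopen) simp
  qed
  fix z assume "z \<in> topspace (T n)"
  then have z: "fst z \<in> \<Omega>" "snd z \<in> \<Omega>" "z \<in> R n" by (auto simp: topspace_Rn_top Rn_def)
  from proj_map[of n] z(2) have "\<exists>U. openin (X 0) U \<and> snd z \<in> U \<and> inj_on (\<pi> n) U"
    by (simp add: locally_injective_open_map_def)
  then obtain U where U: "openin (X 0) U" "snd z \<in> U" "inj_on (\<pi> n) U"
    by (elim exE conjE) (rule that)
  have "openin (T n) {w \<in> topspace (T n). snd w \<in> U}"
    by (rule openin_continuous_map_preimage[OF continuous_snd U(1)])
  moreover have "inj_on fst {w \<in> topspace (T n). snd w \<in> U}"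
  proof (rule inj_onI)
    fix v w assume v: "v \<in> {w \<in> topspace (T n). snd w \<in> U}" and w: "w \<in> {w \<in> topspace (T n). snd w \<in> U}"
      and eq: "fst v = fst w"
    then have "\<pi> n (snd v) = \<pi> n (snd w)" by (auto simp: topspace_Rn_top Rn_def)
    then have "snd v = snd w" using U(3) v w by (auto dest: inj_onD)
    with eq show "v = w" by (rule prod_eqI)
  qed
  ultimately show "\<exists>U. openin (T n) U \<and> z \<in> U \<and> inj_on fst U"
    using z U(2) by (intro exI[of _ "{w \<in> topspace (T n). snd w \<in> U}"]) (simp add: topspace_Rn_top)
qed

text \<open>The class of x is the fibre of \<open>fst\<close> over x, so
  \<open>continuous_map_fibre_sum\<close> applies to \<open>fst\<close>.\<close>

lemma Cont_class_sum:
  assumes f: "continuous_map (T n) euclideanreal f"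
  shows "(\<lambda>x. \<Sum>y\<in>{y. (x, y) \<in> R n}. f (x, y)) \<in> Cont (X 0)"
proof -
  have "(\<Sum>z\<in>{z \<in> topspace (T n). fst z = x}. f z) = (\<Sum>y\<in>{y. (x, y) \<in> R n}. f (x, y))" for x
    by (rule sum.reindex_bij_witness[of _ "\<lambda>y. (x, y)" snd]) (auto simp: topspace_Rn_top)
  with continuous_map_fibre_sum[OF fst_map compact_Rn_top Hausdorff_Rn_top Hausdorff_X f]
  show ?thesis by (simp add: Cont_def)
qed

lemma Cont_class_sum':
  assumes f: "continuous_map (T n) euclideanreal f"
  shows "(\<lambda>y. \<Sum>x\<in>{x. (x, y) \<in> R n}. f (x, y)) \<in> Cont (X 0)"
proof -
  have "{x. (y, x) \<in> R n} = {x. (x, y) \<in> R n}" for y by (auto simp: Rn_iff)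
  then show ?thesis
    using Cont_class_sum[OF continuous_map_compose[OF continuous_swap f]] by simp
qed

text \<open>The inductive limit topology makes each inclusion of R_n into R continuous.\<close>

lemma D_continuous: "continuous_map (T n) euclideanreal D"
proof -
  have D: "continuous_map (R_top X p) euclideanreal D" using cocycle by (simp add: cocycles_def)
  have "continuous_map (T n) (R_top X p) id"
    unfolding continuous_map_def
  proof (intro conjI allI impI)
    show "id \<in> topspace (T n) \<rightarrow> topspace (R_top X p)"
      by (auto simp: topspace_Rn_top topspace_R_top AP_rel_def)
    fix W assume "openin (R_top X p) W"
    then have "openin (T n) (W \<inter> R n)" by (simp add: openin_R_top)
    moreover have "{z \<in> topspace (T n). id z \<in> W} = W \<inter> R n" by (auto simp: topspace_Rn_top)
    ultimately show "openin (T n) {z \<in> topspace (T n). id z \<in> W}" by simp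
  qed
  from continuous_map_compose[OF this D] show ?thesis by (simp only: comp_id)
qed

lemma D_pos: "(x, y) \<in> R n \<Longrightarrow> 0 < D (x, y)"
  using cocycle by (auto simp: cocycles_def topspace_R_top AP_rel_def)

lemma D_mult:
  assumes "(x, y) \<in> R n" "(y, z) \<in> R n"
  shows "D (x, y) * D (y, z) = D (x, z)"
proof -
  have "(x, y) \<in> topspace (R_top X p)" "(y, z) \<in> topspace (R_top X p)"
    using assms by (auto simp: topspace_R_top AP_rel_def)
  with cocycle show ?thesis by (simp add: cocycles_def)
qed

section \<open>Normalized potentials\<close>

definition "is_potential n r \<longleftrightarrow> r \<in> extensional \<Omega> \<and> r \<in> Cont (X 0) \<and> (\<forall>x\<in>\<Omega>. 0 < r x) \<and>
  (\<forall>x y. (x, y) \<in> R n \<longrightarrow> D (x, y) = r x / r y) \<and> (\<forall>\<omega>\<in>topspace (X n). (\<Sum>x\<in>fibre n \<omega>. r x) = 1)"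

text \<open>On a class r(y) = r(x) D(y,x), and the sum over y is 1. This determines r and at the
  same time supplies the formula for its existence.\<close>

lemma potential_class_sum:
  assumes r: "is_potential n r" and x: "x \<in> \<Omega>"
  shows "r x * (\<Sum>y\<in>fibre n (\<pi> n x). D (y, x)) = 1"
proof -
  have "r x * (\<Sum>y\<in>fibre n (\<pi> n x). D (y, x)) = (\<Sum>y\<in>fibre n (\<pi> n x). r y)"
    unfolding sum_distrib_left
  proof (rule sum.cong)
    fix y assume "y \<in> fibre n (\<pi> n x)"
    then have "D (y, x) = r y / r x" using r x by (simp add: is_potential_def Rn_iff)
    moreover have "0 < r x" using r x by (simp add: is_potential_def)
    ultimately show "r x * D (y, x) = r y" by simp
  qed simp
  also have "\<dots> = 1" using r proj_in[OF x] by (simp add: is_potential_def)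
  finally show ?thesis .
qed

lemma potential_exists:
  "is_potential n (restrict (\<lambda>x. 1 / (\<Sum>y\<in>fibre n (\<pi> n x). D (y, x))) \<Omega>)"
proof -
  define s where "s = (\<lambda>x. \<Sum>y\<in>fibre n (\<pi> n x). D (y, x))"
  have s_pos: "0 < s x" if x: "x \<in> \<Omega>" for x
    unfolding s_def using x finite_fibre_proj by (intro sum_pos) (auto intro: D_pos[of _ _ n] simp: Rn_iff)
  \<comment> \<open>By the cocycle identity, multiplying by D(x,y) only moves the base point of the
    normalizing sum from x to y.\<close>
  have s_mult: "s x * D (x, y) = s y" if xy: "(x, y) \<in> R n" for x y
  proof -
    have "\<pi> n x = \<pi> n y" using xy by (simp add: Rn_iff)
    then show ?thesis
      unfolding s_def sum_distrib_right
      by (intro sum.cong) (use xy D_mult[OF _ xy] in \<open>auto simp: Rn_iff\<close>)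
  qed
  have s_cont: "continuous_map (X 0) euclideanreal s"
  proof (rule continuous_map_eq)
    show "continuous_map (X 0) euclideanreal (\<lambda>x. \<Sum>y\<in>{y. (y, x) \<in> R n}. D (y, x))"
      using Cont_class_sum'[OF D_continuous] by (simp add: Cont_def)
  qed (simp add: s_def class_eq_fibre)
  have inv: "D (x, y) = (1 / s x) / (1 / s y)" if xy: "(x, y) \<in> R n" for x y
    using s_mult[OF xy] s_pos[of x] xy by (simp add: Rn_iff field_simps)
  let ?r = "restrict (\<lambda>x. 1 / s x) \<Omega>"
  have "is_potential n ?r"
    unfolding is_potential_def
  proof (intro conjI ballI allI impI)
    have "continuous_map (X 0) euclideanreal (\<lambda>x. 1 / s x)"
      using s_cont s_pos by (intro continuous_map_real_divide) (auto simp: less_imp_neq[symmetric])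
    then show "?r \<in> Cont (X 0)" unfolding Cont_def by (simp add: continuous_map_eq)
    show "D (x, y) = ?r x / ?r y" if "(x, y) \<in> R n" for x y
      using inv[OF that] that by (simp add: Rn_iff)
    fix \<omega> assume "\<omega> \<in> topspace (X n)"
    then obtain y where y: "y \<in> \<Omega>" "\<omega> = \<pi> n y" using proj_surj[of n] by auto
    have "(\<Sum>x\<in>fibre n \<omega>. ?r x) = (\<Sum>x\<in>fibre n (\<pi> n y). D (x, y) / s y)"
      using y by (intro sum.cong) (auto simp: inv Rn_iff s_pos less_imp_neq[symmetric])
    also have "\<dots> = s y / s y" by (simp only: s_def sum_divide_distrib)
    finally show "(\<Sum>x\<in>fibre n \<omega>. ?r x) = 1" using s_pos[OF y(1)] by simp
  qed (use s_pos in auto)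
  then show ?thesis by (simp add: s_def)
qed

lemma rho_potential: "is_potential n (\<rho> n)"
proof -
  have "\<exists>!r. is_potential n r"
  proof (rule ex1I)
    show "is_potential n (restrict (\<lambda>x. 1 / (\<Sum>y\<in>fibre n (\<pi> n x). D (y, x))) \<Omega>)"
      by (rule potential_exists)
    fix r assume r: "is_potential n r"
    show "r = restrict (\<lambda>x. 1 / (\<Sum>y\<in>fibre n (\<pi> n x). D (y, x))) \<Omega>" (is "r = ?r0")
    proof (rule extensionalityI[of _ \<Omega>])
      show "r x = ?r0 x" if x: "x \<in> \<Omega>" for x
        using potential_class_sum[OF r x] x by (simp add: nonzero_eq_divide_eq)
          (metis mult_zero_right zero_neq_one nonzero_eq_divide_eq)
    qed (use r in \<open>auto simp: is_potential_def\<close>)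
  qed
  from theI'[OF this] show ?thesis unfolding rho_def is_potential_def .
qed

lemma rho_Cont: "\<rho> n \<in> Cont (X 0)"
  and rho_pos: "x \<in> \<Omega> \<Longrightarrow> 0 < \<rho> n x"
  and rho_quotient: "(x, y) \<in> R n \<Longrightarrow> D (x, y) = \<rho> n x / \<rho> n y"
  and rho_sum: "\<omega> \<in> topspace (X n) \<Longrightarrow> (\<Sum>x\<in>fibre n \<omega>. \<rho> n x) = 1"
  using rho_potential[of n] by (simp_all add: is_potential_def)

section \<open>Conditional expectations\<close>

lemma Cont_comp_proj: "g \<in> Cont (X n) \<Longrightarrow> (\<lambda>x. g (\<pi> n x)) \<in> Cont (X 0)"
  using continuous_map_compose[OF proj_continuous, of n euclideanreal g] by (simp add: Cont_def o_def)

lemma En_Cont: "f \<in> Cont (X 0) \<Longrightarrow> E n f \<in> Cont (X n)"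
  using continuous_map_fibre_sum[OF proj_map compact_X0 Hausdorff_X Hausdorff_X, where f="\<lambda>x. \<rho> n x * f x"]
    Cont_mult[OF rho_Cont] by (simp add: Cont_def En_def[abs_def])

text \<open>Linearity over functions pulled back from X_n, the characteristic property of a
  conditional expectation; \<open>En_comp_proj\<close> and \<open>En_scale\<close> are
  instances.\<close>

lemma En_module: "E n (\<lambda>x. g (\<pi> n x) * f x) \<omega> = g \<omega> * E n f \<omega>"
  unfolding En_def sum_distrib_left by (rule sum.cong) auto

lemma En_comp_proj: "\<omega> \<in> topspace (X n) \<Longrightarrow> E n (\<lambda>x. g (\<pi> n x)) \<omega> = g \<omega>"
  using En_module[of n g "\<lambda>_. 1" \<omega>] by (simp add: En_def rho_sum)

lemma En_add: "E n (\<lambda>x. f x + g x) \<omega> = E n f \<omega> + E n g \<omega>"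
  by (simp add: En_def distrib_left sum.distrib)

lemma En_scale: "E n (\<lambda>x. c * f x) \<omega> = c * E n f \<omega>"
  using En_module[of n "\<lambda>_. c"] by simp

lemma En_nonneg: "(\<And>x. x \<in> \<Omega> \<Longrightarrow> 0 \<le> f x) \<Longrightarrow> 0 \<le> E n f \<omega>"
  unfolding En_def by (intro sum_nonneg mult_nonneg_nonneg) (auto simp: rho_pos less_imp_le)

lemma En_one: "\<omega> \<in> topspace (X n) \<Longrightarrow> E n (\<lambda>_. 1) \<omega> = 1"
  by (simp add: En_def rho_sum)

lemma Pn_apply: "P n f x = E n f (\<pi> n x)"
  by (simp add: Pn_def)

lemma Pn_Cont: "f \<in> Cont (X 0) \<Longrightarrow> P n f \<in> Cont (X 0)"
  using Cont_comp_proj[OF En_Cont] by (simp add: Pn_apply[abs_def] Pn_def o_def)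

text \<open>Both potentials have quotient D on R_n, so \<rho>_{n+1}/\<rho>_n is constant on the
  classes of R_n and descends to X_n. It stays continuous because \<pi>_n is a quotient map.
  Uniqueness is proved along with existence, \<open>rho_step\<close> being a definite
  description.\<close>

lemma rho_step_props:
  shows rho_step_Cont: "rho_step X p D n \<in> Cont (X n)"
    and rho_step: "x \<in> \<Omega> \<Longrightarrow> \<rho> (Suc n) x = \<rho> n x * rho_step X p D n (\<pi> n x)"
proof -
  define Q where "Q = (\<lambda>r. r \<in> extensional (topspace (X n)) \<and> r \<in> Cont (X n) \<and>
    (\<forall>z\<in>topspace (X n). 0 < r z) \<and> (\<forall>x\<in>\<Omega>. \<rho> (Suc n) x = \<rho> n x * r (\<pi> n x)))"
  define q where "q = (\<lambda>x. \<rho> (Suc n) x / \<rho> n x)"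
  define s where "s = (\<lambda>z. SOME x. x \<in> \<Omega> \<and> \<pi> n x = z)"
  have s: "s z \<in> \<Omega>" "\<pi> n (s z) = z" if "z \<in> topspace (X n)" for z
  proof -
    have "z \<in> \<pi> n ` \<Omega>" using that by (simp only: proj_surj)
    then have "\<exists>x. x \<in> \<Omega> \<and> \<pi> n x = z" by auto
    from someI_ex[OF this] show "s z \<in> \<Omega>" "\<pi> n (s z) = z" by (auto simp: s_def)
  qed
  have q_const: "q x = q y" if xy: "x \<in> \<Omega>" "y \<in> \<Omega>" "\<pi> n x = \<pi> n y" for x y
  proof -
    have "(x, y) \<in> R n" "(x, y) \<in> R (Suc n)" using xy by (simp_all add: Rn_iff)
    then have "\<rho> n x / \<rho> n y = \<rho> (Suc n) x / \<rho> (Suc n) y" by (simp flip: rho_quotient)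
    then show ?thesis
      using rho_pos[OF xy(1), of n] rho_pos[OF xy(2), of n] rho_pos[OF xy(2), of "Suc n"]
      by (simp add: q_def field_simps)
  qed
  define r where "r = restrict (\<lambda>z. q (s z)) (topspace (X n))"
  have r_proj: "r (\<pi> n x) = q x" if x: "x \<in> \<Omega>" for x
    using q_const[OF s(1) x s(2)] proj_in[OF x] by (simp add: r_def)
  have qc: "continuous_map (X 0) euclideanreal q"
    unfolding q_def using rho_Cont rho_pos
    by (intro continuous_map_real_divide) (auto simp: Cont_def less_imp_neq[symmetric])
  have quot: "quotient_map (X 0) (X n) (\<pi> n)"
    using proj_map[of n] proj_surj[of n] unfolding locally_injective_open_map_def
    by (intro continuous_open_imp_quotient_map) simp_all
  have "continuous_map (X 0) euclideanreal (r \<circ> \<pi> n)"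
    using qc by (rule continuous_map_eq) (simp add: r_proj)
  from continuous_compose_quotient_map[OF quot this] have r_Cont: "r \<in> Cont (X n)"
    by (simp add: Cont_def)
  have Qr: "Q r"
    unfolding Q_def
  proof (intro conjI ballI)
    show "0 < r z" if "z \<in> topspace (X n)" for z
      using rho_pos[OF s(1)[OF that]] that by (simp add: r_def q_def)
    show "\<rho> (Suc n) x = \<rho> n x * r (\<pi> n x)" if "x \<in> \<Omega>" for x
      using rho_pos[OF that, of n] by (simp add: r_proj[OF that] q_def)
  qed (simp_all add: r_Cont, simp add: r_def)
  have "\<exists>!r. Q r"
  proof (rule ex1I, rule Qr)
    fix r' assume Q': "Q r'"
    show "r' = r"
    proof (rule extensionalityI[of _ "topspace (X n)"])
      fix z assume z: "z \<in> topspace (X n)"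
      have "\<rho> n (s z) * r' (\<pi> n (s z)) = \<rho> n (s z) * r (\<pi> n (s z))"
        using Q' Qr s(1)[OF z] by (simp add: Q_def)
      then have "\<rho> n (s z) * r' z = \<rho> n (s z) * r z" by (simp only: s(2)[OF z])
      then show "r' z = r z" using rho_pos[OF s(1)[OF z], of n] by simp
    qed (use Q' Qr in \<open>simp_all add: Q_def\<close>)
  qed
  from theI'[OF this] have "Q (rho_step X p D n)" unfolding rho_step_def Q_def .
  then show "rho_step X p D n \<in> Cont (X n)"
    and "x \<in> \<Omega> \<Longrightarrow> \<rho> (Suc n) x = \<rho> n x * rho_step X p D n (\<pi> n x)"
    by (simp_all add: Q_def)
qed

lemma E_step_Cont: "f \<in> Cont (X n) \<Longrightarrow> E_step X p D n f \<in> Cont (X (Suc n))"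
  using continuous_map_fibre_sum[OF step_map compact_X Hausdorff_X Hausdorff_X, where f="\<lambda>z. rho_step X p D n z * f z"]
    Cont_mult[OF rho_step_Cont] by (simp add: Cont_def E_step_def[abs_def])

text \<open>\<pi>_n partitions the fibre of \<pi>_{n+1} over \<omega> into its fibres over the
  points z with p_n(z) = \<omega>, and \<rho>_{n+1} is \<rho>_n times the weight of z.\<close>

lemma E_step_En: "E_step X p D n (E n f) \<omega> = E (Suc n) f \<omega>"
proof -
  have "E_step X p D n (E n f) \<omega> =
      (\<Sum>z\<in>{z \<in> topspace (X n). p n z = \<omega>}. \<Sum>x\<in>{x \<in> fibre (Suc n) \<omega>. \<pi> n x = z}. \<rho> (Suc n) x * f x)"
    unfolding E_step_def En_def sum_distrib_left
  proof (intro sum.cong refl)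
    fix z assume z: "z \<in> {z \<in> topspace (X n). p n z = \<omega>}"
    then show "fibre n z = {x \<in> fibre (Suc n) \<omega>. \<pi> n x = z}" by auto
    fix x assume "x \<in> {x \<in> fibre (Suc n) \<omega>. \<pi> n x = z}"
    then show "rho_step X p D n z * (\<rho> n x * f x) = \<rho> (Suc n) x * f x"
      using rho_step[of x n] by auto
  qed
  also have "\<dots> = E (Suc n) f \<omega>"
    unfolding En_def
    by (rule sum.group) (use finite_fibre_proj[of "Suc n" \<omega>] finite_fibre_step proj_in in auto)
  finally show ?thesis .
qed

lemma E_step_cong: "(\<And>z. z \<in> topspace (X n) \<Longrightarrow> f z = g z) \<Longrightarrow> E_step X p D n f \<omega> = E_step X p D n g \<omega>"
  unfolding E_step_def by (rule sum.cong) auto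

text \<open>On X_n the function g is E_n of its own pullback. The step expectation is thus expressed
  by E_{n+1} alone, and later arguments avoid computing with \<open>rho_step\<close>.\<close>

lemma E_step_eq_En: "E_step X p D n g \<omega> = E (Suc n) (\<lambda>x. g (\<pi> n x)) \<omega>"
  unfolding E_step_En[symmetric] by (rule E_step_cong) (simp add: En_comp_proj)

text \<open>Both sides are E_{n+1,n} applied to E_n f: one by \<open>E_step_eq_En\<close>, the other
  by \<open>E_step_En\<close>.\<close>

lemma En_Suc_Pn: "E (Suc n) (P n f) \<omega> = E (Suc n) f \<omega>"
  unfolding Pn_apply[abs_def] E_step_eq_En[symmetric] by (rule E_step_En)

end

section \<open>Quasi-invariant measures\<close>

context AP_cocycle
begin

section \<open>Quasi-invariance under R_n as invariance under P_n\<close>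

lemma Cc_Rn_top: "Cc (T n) = {f. continuous_map (T n) euclideanreal f}"
  by (auto simp: Cc_def intro: closedin_compact_space compact_Rn_top)

lemma infsum_class: "(\<Sum>\<^sub>\<infinity>y\<in>{y. (x, y) \<in> topspace (T n)}. h y) = (\<Sum>y\<in>{y. (x, y) \<in> R n}. (h y :: real))"
  "(\<Sum>\<^sub>\<infinity>y\<in>{y. (y, x) \<in> topspace (T n)}. h y) = (\<Sum>y\<in>{y. (y, x) \<in> R n}. (h y :: real))"
  by (simp_all add: topspace_Rn_top finite_class)

text \<open>Both sides are one double sum over the square of a fibre, read in the two orders; D
  accounts for the change of weight.\<close>

lemma En_class_sums:
  "E n (\<lambda>x. \<Sum>y\<in>{y. (x, y) \<in> R n}. f (x, y)) \<omega> = E n (\<lambda>y. \<Sum>x\<in>{x. (x, y) \<in> R n}. f (x, y) * D (x, y)) \<omega>"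
proof -
  have "E n (\<lambda>x. \<Sum>y\<in>{y. (x, y) \<in> R n}. f (x, y)) \<omega> = (\<Sum>x\<in>fibre n \<omega>. \<Sum>y\<in>fibre n \<omega>. \<rho> n x * f (x, y))"
    unfolding En_def sum_distrib_left
  proof (rule sum.cong[OF refl])
    fix x assume "x \<in> fibre n \<omega>"
    then have "{y. (x, y) \<in> R n} = fibre n \<omega>" using class_eq_fibre(1)[of x n] by simp
    then show "(\<Sum>y\<in>{y. (x, y) \<in> R n}. \<rho> n x * f (x, y)) = (\<Sum>y\<in>fibre n \<omega>. \<rho> n x * f (x, y))"
      by (simp only:)
  qed
  also have "\<dots> = (\<Sum>y\<in>fibre n \<omega>. \<Sum>x\<in>fibre n \<omega>. \<rho> n x * f (x, y))" by (rule sum.swap)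
  also have "\<dots> = E n (\<lambda>y. \<Sum>x\<in>{x. (x, y) \<in> R n}. f (x, y) * D (x, y)) \<omega>"
    unfolding En_def sum_distrib_left
  proof (rule sum.cong[OF refl])
    fix y assume y: "y \<in> fibre n \<omega>"
    then have c: "{x. (x, y) \<in> R n} = fibre n \<omega>" using class_eq_fibre(2)[of y n] by simp
    have "\<rho> n x * f (x, y) = \<rho> n y * (f (x, y) * D (x, y))" if "x \<in> fibre n \<omega>" for x
    proof -
      have "(x, y) \<in> R n" using that y by (simp add: Rn_iff)
      then show ?thesis using rho_pos[of y n] y by (simp add: rho_quotient)
    qed
    then show "(\<Sum>x\<in>fibre n \<omega>. \<rho> n x * f (x, y)) = (\<Sum>x\<in>{x. (x, y) \<in> R n}. \<rho> n y * (f (x, y) * D (x, y)))"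
      unfolding c by (rule sum.cong[OF refl])
  qed
  finally show ?thesis .
qed

lemma S_Dn_alt:
  "\<mu> \<in> S_Dn X p D n \<longleftrightarrow> \<mu> \<in> Prob (X 0) \<and> (\<forall>f. continuous_map (T n) euclideanreal f \<longrightarrow>
     (\<integral>x. (\<Sum>y\<in>{y. (x, y) \<in> R n}. f (x, y)) \<partial>\<mu>) = (\<integral>y. (\<Sum>x\<in>{x. (x, y) \<in> R n}. f (x, y) * D (x, y)) \<partial>\<mu>))"
proof -
  have "(\<Sum>x\<in>{x. (x, y) \<in> R n}. f (x, y) * restrict D (R n) (x, y)) = (\<Sum>x\<in>{x. (x, y) \<in> R n}. f (x, y) * D (x, y))"
    for f y by (rule sum.cong) auto
  then show ?thesis
    unfolding S_Dn_def quasi_invariant_def infsum_class Cc_Rn_top by simp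
qed

lemma S_Dn_iff: "\<mu> \<in> S_Dn X p D n \<longleftrightarrow> \<mu> \<in> Prob (X 0) \<and> is_comp (X 0) \<mu> (P n) \<mu>"
proof
  assume "\<mu> \<in> S_Dn X p D n"
  then have \<mu>: "\<mu> \<in> Prob (X 0)" and inv: "\<And>f. continuous_map (T n) euclideanreal f \<Longrightarrow>
     (\<integral>x. (\<Sum>y\<in>{y. (x, y) \<in> R n}. f (x, y)) \<partial>\<mu>) = (\<integral>y. (\<Sum>x\<in>{x. (x, y) \<in> R n}. f (x, y) * D (x, y)) \<partial>\<mu>)"
    by (simp_all add: S_Dn_alt)
  have "(\<integral>x. g x \<partial>\<mu>) = (\<integral>x. P n g x \<partial>\<mu>)" if g: "g \<in> Cont (X 0)" for g
  proof -
    have "continuous_map (T n) euclideanreal (g \<circ> fst)" "continuous_map (T n) euclideanreal (\<rho> n \<circ> snd)"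
      using g rho_Cont[of n] by (simp_all add: Cont_def continuous_map_compose[OF continuous_fst]
          continuous_map_compose[OF continuous_snd])
    then have c: "continuous_map (T n) euclideanreal (\<lambda>z. g (fst z) * \<rho> n (snd z))"
      by (simp add: o_def continuous_map_real_mult)
    have "(\<integral>x. g x \<partial>\<mu>) = (\<integral>x. (\<Sum>y\<in>{y. (x, y) \<in> R n}. g x * \<rho> n y) \<partial>\<mu>)"
    proof (rule Prob_integral_cong[OF \<mu>])
      fix x assume x: "x \<in> \<Omega>"
      show "g x = (\<Sum>y\<in>{y. (x, y) \<in> R n}. g x * \<rho> n y)"
        unfolding class_eq_fibre[OF x] sum_distrib_left[symmetric] rho_sum[OF proj_in[OF x]] by simp
    qed
    also have "\<dots> = (\<integral>y. (\<Sum>x\<in>{x. (x, y) \<in> R n}. g x * \<rho> n y * D (x, y)) \<partial>\<mu>)"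
      using inv[OF c] by simp
    also have "\<dots> = (\<integral>y. P n g y \<partial>\<mu>)"
    proof (rule Prob_integral_cong[OF \<mu>])
      fix y assume y: "y \<in> \<Omega>"
      show "(\<Sum>x\<in>{x. (x, y) \<in> R n}. g x * \<rho> n y * D (x, y)) = P n g y"
        unfolding Pn_apply En_def class_eq_fibre(2)[OF y, symmetric]
      proof (rule sum.cong[OF refl])
        fix x assume "x \<in> {x. (x, y) \<in> R n}"
        then show "g x * \<rho> n y * D (x, y) = \<rho> n x * g x"
          using rho_pos[OF y, of n] by (simp add: rho_quotient)
      qed
    qed
    finally show ?thesis .
  qed
  with \<mu> show "\<mu> \<in> Prob (X 0) \<and> is_comp (X 0) \<mu> (P n) \<mu>" by (simp add: is_comp_def)
next
  assume "\<mu> \<in> Prob (X 0) \<and> is_comp (X 0) \<mu> (P n) \<mu>"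
  then have \<mu>: "\<mu> \<in> Prob (X 0)" and inv: "\<And>f. f \<in> Cont (X 0) \<Longrightarrow> (\<integral>x. f x \<partial>\<mu>) = (\<integral>x. P n f x \<partial>\<mu>)"
    by (simp_all add: is_comp_def)
  show "\<mu> \<in> S_Dn X p D n"
    unfolding S_Dn_alt
  proof (intro conjI allI impI \<mu>)
    fix f assume f: "continuous_map (T n) euclideanreal f"
    \<comment> \<open>Invariance replaces each side by the integral of its expectation, and the two
      expectations coincide.\<close>
    note inv[OF Cont_class_sum[OF f]]
    moreover note inv[OF Cont_class_sum'[OF continuous_map_real_mult[OF f D_continuous]]]
    ultimately show "(\<integral>x. (\<Sum>y\<in>{y. (x, y) \<in> R n}. f (x, y)) \<partial>\<mu>) = (\<integral>y. (\<Sum>x\<in>{x. (x, y) \<in> R n}. f (x, y) * D (x, y)) \<partial>\<mu>)"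
      by (simp only: Pn_apply En_class_sums)
  qed
qed

lemma S_Dn_Prob: "\<mu> \<in> S_Dn X p D n \<Longrightarrow> \<mu> \<in> Prob (X 0)"
  and S_Dn_integral: "\<mu> \<in> S_Dn X p D n \<Longrightarrow> f \<in> Cont (X 0) \<Longrightarrow> (\<integral>x. f x \<partial>\<mu>) = (\<integral>x. P n f x \<partial>\<mu>)"
  by (simp_all add: S_Dn_iff is_comp_def)

lemma decseq_S_Dn: "decseq (S_Dn X p D)"
  unfolding decseq_Suc_iff
proof (intro allI subsetI)
  fix n \<mu> assume \<mu>: "\<mu> \<in> S_Dn X p D (Suc n)"
  have "(\<integral>x. f x \<partial>\<mu>) = (\<integral>x. P n f x \<partial>\<mu>)" if f: "f \<in> Cont (X 0)" for f
  proof -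
    have "P (Suc n) (P n f) = P (Suc n) f"
      by (rule ext) (simp only: Pn_apply[of "Suc n"] En_Suc_Pn)
    then show ?thesis
      using S_Dn_integral[OF \<mu> f] S_Dn_integral[OF \<mu> Pn_Cont[OF f]] by simp
  qed
  with S_Dn_Prob[OF \<mu>] show "\<mu> \<in> S_Dn X p D n" by (simp add: S_Dn_iff is_comp_def)
qed

section \<open>The inductive limit topology on R\<close>

lemma Rn_top_subtopology: "m \<le> n \<Longrightarrow> T m = subtopology (T n) (R m)"
  unfolding Rn_top_def subtopology_subtopology using Rn_mono[of m n] by (simp add: Int_absorb1)

text \<open>Take a neighbourhood U of the common \<pi>_n-image on which p_n is injective. For pairs
  of R_{n+1} with both \<pi>_n-images in U, agreement after p_n is already agreement before
  it.\<close>

lemma openin_Rn_Suc: "openin (T (Suc n)) (R n)"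
proof (subst openin_subopen, rule ballI)
  fix z assume z: "z \<in> R n"
  then have zz: "fst z \<in> \<Omega>" "snd z \<in> \<Omega>" "\<pi> n (fst z) = \<pi> n (snd z)" by (auto simp: Rn_def)
  from step_map[of n] proj_in[OF zz(1)]
  have "\<exists>U. openin (X n) U \<and> \<pi> n (fst z) \<in> U \<and> inj_on (p n) U"
    by (simp add: locally_injective_open_map_def)
  then obtain U where U: "openin (X n) U" "\<pi> n (fst z) \<in> U" "inj_on (p n) U"
    by (elim exE conjE) (rule that)
  let ?W = "{w \<in> topspace (T (Suc n)). (\<pi> n \<circ> fst) w \<in> U} \<inter> {w \<in> topspace (T (Suc n)). (\<pi> n \<circ> snd) w \<in> U}"
  have "openin (T (Suc n)) ?W"
    by (intro openin_Int openin_continuous_map_preimage[OF continuous_map_compose[OF continuous_fst proj_continuous] U(1)]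
      openin_continuous_map_preimage[OF continuous_map_compose[OF continuous_snd proj_continuous] U(1)])
  moreover have "z \<in> ?W" using z zz(3) U(2) Rn_Suc[of n] by (auto simp: topspace_Rn_top)
  moreover have "?W \<subseteq> R n"
  proof
    fix w assume w: "w \<in> ?W"
    then have "w \<in> R (Suc n)" and wU: "\<pi> n (fst w) \<in> U" "\<pi> n (snd w) \<in> U" by (auto simp: topspace_Rn_top)
    then have w': "fst w \<in> \<Omega>" "snd w \<in> \<Omega>" "p n (\<pi> n (fst w)) = p n (\<pi> n (snd w))" by (auto simp: Rn_def)
    from inj_onD[OF U(3) w'(3) wU] w' show "w \<in> R n" by (auto simp: Rn_def)
  qed
  ultimately show "\<exists>W. openin (T (Suc n)) W \<and> z \<in> W \<and> W \<subseteq> R n" by (intro exI[of _ ?W] conjI)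
qed

lemma openin_Rn: "m \<le> n \<Longrightarrow> openin (T n) (R m)"
proof (induction n rule: dec_induct)
  case base
  then show ?case using openin_topspace[of "T m"] by (simp add: topspace_Rn_top)
next
  case (step n)
  then have "openin (subtopology (T (Suc n)) (R n)) (R m)"
    by (simp flip: Rn_top_subtopology)
  then show ?case by (simp add: openin_open_subtopology openin_Rn_Suc)
qed

text \<open>Against R_m with m \<le> n this is restriction; for larger m it rests on R_n being open
  in R_m. Hence R induces on each R_n its original topology.\<close>

lemma openin_R_top_if_openin_Rn_top:
  assumes S: "openin (T n) S" shows "openin (R_top X p) S"
proof -
  have SR: "S \<subseteq> R n" using openin_subset[OF S] by (simp add: topspace_Rn_top)
  have "openin (T m) (S \<inter> R m)" for m
  proof (cases "m \<le> n")
    case True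
    from openin_subtopology_Int[OF S] show ?thesis by (simp only: Rn_top_subtopology[OF True])
  next
    case False
    then have mn: "n \<le> m" by simp
    from S have "openin (T m) S"
      unfolding Rn_top_subtopology[OF mn] by (simp add: openin_open_subtopology openin_Rn[OF mn])
    moreover have "S \<inter> R m = S" using SR Rn_mono[OF mn] by blast
    ultimately show ?thesis by simp
  qed
  with SR show ?thesis by (auto simp: openin_R_top AP_rel_def)
qed

lemma Rn_subset_AP_rel: "R n \<subseteq> AP_rel X p"
  by (auto simp: AP_rel_def)

lemma subtopology_R_top: "subtopology (R_top X p) (R n) = T n"
  unfolding topology_eq
proof (intro allI iffI)
  fix S assume "openin (subtopology (R_top X p) (R n)) S"
  then show "openin (T n) S" by (auto simp: openin_subtopology openin_R_top)
next
  fix S assume S: "openin (T n) S"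
  then have "S \<subseteq> R n" using openin_subset by (fastforce simp: topspace_Rn_top)
  then have "S = S \<inter> R n" by blast
  with openin_R_top_if_openin_Rn_top[OF S] show "openin (subtopology (R_top X p) (R n)) S"
    unfolding openin_subtopology by (intro exI[of _ S] conjI)
qed

lemma compactin_R_top_Rn: "compactin (R_top X p) (R n)"
  by (simp add: compactin_subspace topspace_R_top Rn_subset_AP_rel subtopology_R_top compact_Rn_top)

lemma openin_R_top_Rn: "openin (R_top X p) (R n)"
  by (rule openin_R_top_if_openin_Rn_top[OF openin_Rn[OF order_refl]])

text \<open>Being closed in the product, R_n meets every R_m in a closed set. With
  \<open>openin_R_top_Rn\<close> it is clopen in R, so extending a function by zero keeps it
  continuous and its support inside R_n.\<close>

lemma closedin_R_top_Rn: "closedin (R_top X p) (R n)"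
  unfolding closedin_def topspace_R_top openin_R_top
proof (intro conjI allI Rn_subset_AP_rel)
  fix m
  have "closedin (T m) (R n \<inter> R m)"
    unfolding Rn_top_def closedin_subtopology using closedin_Rn by blast
  then have "openin (T m) (topspace (T m) - R n \<inter> R m)" by blast
  moreover have "topspace (T m) - R n \<inter> R m = (AP_rel X p - R n) \<inter> R m"
    using Rn_subset_AP_rel[of m] by (auto simp: topspace_Rn_top)
  ultimately show "openin (T m) ((AP_rel X p - R n) \<inter> R m)" by simp
qed auto

lemma compactin_R_top_subset:
  assumes K: "compactin (R_top X p) K" shows "\<exists>n. K \<subseteq> R n"
proof -
  have "K \<subseteq> \<Union>(range R)"
    using compactin_subset_topspace[OF K] by (simp add: topspace_R_top AP_rel_def)
  with K have "\<exists>\<F>. finite \<F> \<and> \<F> \<subseteq> range R \<and> K \<subseteq> \<Union>\<F>"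
    by (intro compactinD) (auto intro: openin_R_top_Rn)
  then obtain \<F> where F: "finite \<F>" "\<F> \<subseteq> range R" "K \<subseteq> \<Union>\<F>" by (elim exE conjE) (rule that)
  from finite_subset_image[OF F(1,2)] obtain J where J: "finite J" "\<F> = R ` J" by auto
  \<comment> \<open>Inserting 0 gives \<open>Max\<close> a value when the subcover is empty.\<close>
  have "R j \<subseteq> R (Max (insert 0 J))" if "j \<in> J" for j
    using that J by (intro Rn_mono) simp
  with F(3) J have "K \<subseteq> R (Max (insert 0 J))" by blast
  then show ?thesis ..
qed

text \<open>A class of R may be infinite, but h vanishes off R_n, whose classes are finite; no
  question of summability arises.\<close>

lemma infsum_R_eq:
  fixes h :: "'a \<times> 'a \<Rightarrow> real"
  assumes "\<And>z. z \<in> AP_rel X p \<Longrightarrow> z \<notin> R n \<Longrightarrow> h z = 0"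
  shows "(\<Sum>\<^sub>\<infinity>y\<in>{y. (x, y) \<in> topspace (R_top X p)}. h (x, y)) = (\<Sum>y\<in>{y. (x, y) \<in> R n}. h (x, y))"
    and "(\<Sum>\<^sub>\<infinity>y\<in>{y. (y, x) \<in> topspace (R_top X p)}. h (y, x)) = (\<Sum>y\<in>{y. (y, x) \<in> R n}. h (y, x))"
proof -
  have "(\<Sum>\<^sub>\<infinity>y\<in>{y. (x, y) \<in> topspace (R_top X p)}. h (x, y)) = (\<Sum>\<^sub>\<infinity>y\<in>{y. (x, y) \<in> R n}. h (x, y))"
    by (rule infsum_cong_neutral) (use assms Rn_subset_AP_rel in \<open>auto simp: topspace_R_top\<close>)
  then show "(\<Sum>\<^sub>\<infinity>y\<in>{y. (x, y) \<in> topspace (R_top X p)}. h (x, y)) = (\<Sum>y\<in>{y. (x, y) \<in> R n}. h (x, y))"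
    by (simp add: finite_class)
  have "(\<Sum>\<^sub>\<infinity>y\<in>{y. (y, x) \<in> topspace (R_top X p)}. h (y, x)) = (\<Sum>\<^sub>\<infinity>y\<in>{y. (y, x) \<in> R n}. h (y, x))"
    by (rule infsum_cong_neutral) (use assms Rn_subset_AP_rel in \<open>auto simp: topspace_R_top\<close>)
  then show "(\<Sum>\<^sub>\<infinity>y\<in>{y. (y, x) \<in> topspace (R_top X p)}. h (y, x)) = (\<Sum>y\<in>{y. (y, x) \<in> R n}. h (y, x))"
    by (simp add: finite_class)
qed

lemma Cc_extend_zero:
  assumes f: "continuous_map (T n) euclideanreal f"
  shows "(\<lambda>z. if z \<in> R n then f z else 0) \<in> Cc (R_top X p)" (is "?f \<in> _")
proof -
  have "continuous_map (R_top X p) euclideanreal ?f"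
    unfolding continuous_map_def
  proof (intro conjI allI impI)
    fix S :: "real set" assume S: "openin euclideanreal S"
    have 1: "openin (R_top X p) {z \<in> topspace (T n). f z \<in> S}"
      by (rule openin_R_top_if_openin_Rn_top[OF openin_continuous_map_preimage[OF f S]])
    have 2: "openin (R_top X p) (topspace (R_top X p) - R n)"
      using closedin_R_top_Rn by blast
    have "{z \<in> topspace (R_top X p). ?f z \<in> S} = {z \<in> topspace (T n). f z \<in> S} \<union>
        (if 0 \<in> S then topspace (R_top X p) - R n else {})"
      using Rn_subset_AP_rel by (auto simp: topspace_Rn_top topspace_R_top)
    with 1 2 show "openin (R_top X p) {z \<in> topspace (R_top X p). ?f z \<in> S}"
      by (simp add: openin_Un)
  qed simp
  moreover have "R_top X p closure_of {z \<in> topspace (R_top X p). ?f z \<noteq> 0} \<subseteq> R n"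
    by (rule closure_of_minimal[OF _ closedin_R_top_Rn]) (auto split: if_splits)
  then have "compactin (R_top X p) (R_top X p closure_of {z \<in> topspace (R_top X p). ?f z \<noteq> 0})"
    by (rule closed_compactin[OF compactin_R_top_Rn]) simp
  ultimately show ?thesis by (simp add: Cc_def)
qed

text \<open>A test function on R is carried by some R_n, and one on R_n extends by zero to R; in
  both directions \<open>infsum_R_eq\<close> identifies the inner sums.\<close>

lemma Inter_S_Dn: "(\<Inter>n. S_Dn X p D n) = S_D X p D"
proof
  show "(\<Inter>n. S_Dn X p D n) \<subseteq> S_D X p D"
  proof
    fix \<mu> assume \<mu>: "\<mu> \<in> (\<Inter>n. S_Dn X p D n)"
    show "\<mu> \<in> S_D X p D"
      unfolding S_D_def quasi_invariant_def
    proof (intro CollectI conjI ballI)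
      show "\<mu> \<in> Prob (X 0)" using \<mu> S_Dn_Prob by blast
      fix f assume f: "f \<in> Cc (R_top X p)"
      let ?K = "R_top X p closure_of {z \<in> topspace (R_top X p). f z \<noteq> 0}"
      have "compactin (R_top X p) ?K" using f by (simp add: Cc_def)
      from compactin_R_top_subset[OF this] obtain n where n: "?K \<subseteq> R n" ..
      have zero: "f z = 0" if "z \<in> AP_rel X p" "z \<notin> R n" for z
      proof (rule ccontr)
        assume "f z \<noteq> 0"
        then have "z \<in> {z \<in> topspace (R_top X p). f z \<noteq> 0}" using that by (simp add: topspace_R_top)
        also have "\<dots> \<subseteq> ?K" by (rule closure_of_subset) auto
        finally show False using n that by blast
      qed
      have "continuous_map (subtopology (R_top X p) (R n)) euclideanreal f"
        using f by (intro continuous_map_from_subtopology) (simp add: Cc_def)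
      then have "continuous_map (T n) euclideanreal f" by (simp add: subtopology_R_top)
      with \<mu> have eq: "(\<integral>x. (\<Sum>y\<in>{y. (x, y) \<in> R n}. f (x, y)) \<partial>\<mu>) =
          (\<integral>y. (\<Sum>x\<in>{x. (x, y) \<in> R n}. f (x, y) * D (x, y)) \<partial>\<mu>)"
        by (auto simp: S_Dn_alt)
      show "(\<integral>x. (\<Sum>\<^sub>\<infinity>y\<in>{y. (x, y) \<in> topspace (R_top X p)}. f (x, y)) \<partial>\<mu>) =
          (\<integral>y. (\<Sum>\<^sub>\<infinity>x\<in>{x. (x, y) \<in> topspace (R_top X p)}. f (x, y) * D (x, y)) \<partial>\<mu>)"
        using eq infsum_R_eq(1)[of n f, OF zero] infsum_R_eq(2)[of n "\<lambda>z. f z * D z"] zero by simp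
    qed
  qed
  show "S_D X p D \<subseteq> (\<Inter>n. S_Dn X p D n)"
  proof (intro subsetI INT_I)
    fix \<mu> n assume \<mu>: "\<mu> \<in> S_D X p D"
    show "\<mu> \<in> S_Dn X p D n"
      unfolding S_Dn_alt
    proof (intro conjI allI impI)
      show "\<mu> \<in> Prob (X 0)" using \<mu> by (simp add: S_D_def quasi_invariant_def)
      fix f assume f: "continuous_map (T n) euclideanreal f"
      define g where "g = (\<lambda>z. if z \<in> R n then f z else 0)"
      from \<mu> have "\<forall>g\<in>Cc (R_top X p). (\<integral>x. (\<Sum>\<^sub>\<infinity>y\<in>{y. (x, y) \<in> topspace (R_top X p)}. g (x, y)) \<partial>\<mu>) =
          (\<integral>y. (\<Sum>\<^sub>\<infinity>x\<in>{x. (x, y) \<in> topspace (R_top X p)}. g (x, y) * D (x, y)) \<partial>\<mu>)"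
        by (simp add: S_D_def quasi_invariant_def)
      note bspec[OF this Cc_extend_zero[OF f, folded g_def]]
      moreover have "(\<Sum>\<^sub>\<infinity>y\<in>{y. (x, y) \<in> topspace (R_top X p)}. g (x, y)) = (\<Sum>y\<in>{y. (x, y) \<in> R n}. f (x, y))" for x
        by (subst infsum_R_eq(1)[of n g]) (auto simp: g_def intro!: sum.cong)
      moreover have "(\<Sum>\<^sub>\<infinity>x\<in>{x. (x, y) \<in> topspace (R_top X p)}. g (x, y) * D (x, y)) = (\<Sum>x\<in>{x. (x, y) \<in> R n}. f (x, y) * D (x, y))" for y
        by (subst infsum_R_eq(2)[of n "\<lambda>z. g z * D z"]) (auto simp: g_def intro!: sum.cong)
      ultimately show "(\<integral>x. (\<Sum>y\<in>{y. (x, y) \<in> R n}. f (x, y)) \<partial>\<mu>) =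
          (\<integral>y. (\<Sum>x\<in>{x. (x, y) \<in> R n}. f (x, y) * D (x, y)) \<partial>\<mu>)" by simp
    qed
  qed
qed

lemma S_D_eq_G_measures: "S_D X p D = G_measures X p D"
  unfolding Inter_S_Dn[symmetric] by (auto simp: S_Dn_iff G_measures_def)

section \<open>The dual maps of the expectations\<close>

lemmas integral_mix_X = compact_second_countable.integral_mix[OF compact_second_countable]
lemmas Prob_eqI_X = compact_second_countable.Prob_eqI[OF compact_second_countable]
lemmas compact_convex_weak_star_X = compact_second_countable.compact_convex_weak_star[OF compact_second_countable]

lemma compact_weak_star_X: "compact_space (weak_star (X n))"
  and Hausdorff_weak_star_X: "Hausdorff_space (weak_star (X n))"
  using compact_convex_weak_star_X[of n] by (simp_all add: compact_convex_def)

text \<open>Composing with E_n turns a state into a state, as E_n is linear, positive and unital;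
  Riesz does the rest.\<close>

lemma E_star_unique:
  assumes \<mu>: "\<mu> \<in> Prob (X n)"
  shows "\<exists>!\<nu>. \<nu> \<in> Prob (X 0) \<and> is_comp (X 0) \<nu> (E n) \<mu>"
  unfolding is_comp_def
proof (rule compact_second_countable.riesz_representation[OF compact_second_countable])
  have "state (X n) (\<lambda>f. \<integral>x. f x \<partial>\<mu>)"
    using \<mu> by (rule compact_second_countable.state_integral[OF compact_second_countable])
  moreover have "(\<integral>\<omega>. E n (\<lambda>_. 1) \<omega> \<partial>\<mu>) = 1"
    using Prob_integral_cong[OF \<mu> En_one] Prob_integral_const[OF \<mu>, of 1] by simp
  ultimately show "state (X 0) (\<lambda>f. \<integral>\<omega>. E n f \<omega> \<partial>\<mu>)"
    unfolding state_def En_add En_scale by (simp add: En_Cont En_nonneg)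
qed

lemma E_star_props:
  assumes "\<mu> \<in> Prob (X n)"
  shows E_star_Prob: "E_star X p D n \<mu> \<in> Prob (X 0)"
    and E_star_integral: "f \<in> Cont (X 0) \<Longrightarrow> (\<integral>x. f x \<partial>E_star X p D n \<mu>) = (\<integral>\<omega>. E n f \<omega> \<partial>\<mu>)"
  using theI'[OF E_star_unique[OF assms]] by (simp_all add: E_star_def is_comp_def)

lemma E_star_eqI:
  assumes "\<mu> \<in> Prob (X n)" "\<nu> \<in> Prob (X 0)"
    and "\<And>f. f \<in> Cont (X 0) \<Longrightarrow> (\<integral>x. f x \<partial>\<nu>) = (\<integral>\<omega>. E n f \<omega> \<partial>\<mu>)"
  shows "E_star X p D n \<mu> = \<nu>"
  unfolding E_star_def using E_star_unique[OF assms(1)] assms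
  by (intro the1_equality) (simp_all add: is_comp_def)

definition push :: "nat \<Rightarrow> 'a measure \<Rightarrow> 'a measure" where
  "push n \<nu> = distr \<nu> (borel_on (X n)) (\<pi> n)"

lemma proj_measurable:
  assumes \<nu>: "\<nu> \<in> Prob (X 0)"
  shows "\<pi> n \<in> measurable \<nu> (borel_on (X n))"
  unfolding borel_on_def
proof (rule measurable_measure_of)
  show "\<pi> n \<in> space \<nu> \<rightarrow> topspace (X n)" using proj_in by (auto simp: Prob_space[OF \<nu>])
  fix U assume "U \<in> {U. openin (X n) U}"
  then have "openin (X 0) {x \<in> \<Omega>. \<pi> n x \<in> U}"
    by (intro openin_continuous_map_preimage[OF proj_continuous]) simp
  moreover have "\<pi> n -` U \<inter> space \<nu> = {x \<in> \<Omega>. \<pi> n x \<in> U}" by (auto simp: Prob_space[OF \<nu>])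
  ultimately show "\<pi> n -` U \<inter> space \<nu> \<in> sets \<nu>"
    by (simp add: Prob_sets[OF \<nu>] sets_borel_on sigma_sets.Basic)
qed (auto dest: openin_subset)

lemma push_Prob:
  assumes \<nu>: "\<nu> \<in> Prob (X 0)" shows "push n \<nu> \<in> Prob (X n)"
proof -
  have "\<pi> n -` topspace (X n) \<inter> space \<nu> = space \<nu>" using proj_in by (auto simp: Prob_space[OF \<nu>])
  moreover have "topspace (X n) \<in> sets (borel_on (X n))"
    using sets.top[of "borel_on (X n)"] by (simp add: space_borel_on)
  ultimately have "emeasure (push n \<nu>) (topspace (X n)) = 1"
    using \<nu> unfolding push_def by (simp add: emeasure_distr[OF proj_measurable] Prob_def)
  then show ?thesis by (simp add: Prob_def push_def space_borel_on)
qed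

lemma push_integral:
  assumes "\<nu> \<in> Prob (X 0)" "g \<in> Cont (X n)"
  shows "(\<integral>\<omega>. g \<omega> \<partial>push n \<nu>) = (\<integral>x. g (\<pi> n x) \<partial>\<nu>)"
  unfolding push_def by (rule integral_distr[OF proj_measurable Cont_measurable]) (fact assms)+

lemma E_star_S_Dn:
  assumes \<mu>: "\<mu> \<in> Prob (X n)" shows "E_star X p D n \<mu> \<in> S_Dn X p D n"
  unfolding S_Dn_iff is_comp_def
proof (intro conjI ballI E_star_Prob[OF \<mu>])
  fix f assume f: "f \<in> Cont (X 0)"
  have "(\<integral>\<omega>. E n (P n f) \<omega> \<partial>\<mu>) = (\<integral>\<omega>. E n f \<omega> \<partial>\<mu>)"
    by (rule Prob_integral_cong[OF \<mu>]) (simp add: Pn_apply[abs_def] En_comp_proj)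
  then show "(\<integral>x. f x \<partial>E_star X p D n \<mu>) = (\<integral>x. P n f x \<partial>E_star X p D n \<mu>)"
    by (simp add: E_star_integral[OF \<mu>] f Pn_Cont)
qed

text \<open>The dual form of E_n(g \<circ> \<pi>_n) = g; it makes \<open>E_star\<close> injective on
  all of \<open>Prob (X n)\<close>.\<close>

lemma push_E_star:
  assumes \<mu>: "\<mu> \<in> Prob (X n)" shows "push n (E_star X p D n \<mu>) = \<mu>"
proof (rule Prob_eqI_X[OF push_Prob[OF E_star_Prob[OF \<mu>]] \<mu>])
  fix g assume g: "g \<in> Cont (X n)"
  have "(\<integral>\<omega>. E n (\<lambda>x. g (\<pi> n x)) \<omega> \<partial>\<mu>) = (\<integral>\<omega>. g \<omega> \<partial>\<mu>)"
    by (rule Prob_integral_cong[OF \<mu>]) (rule En_comp_proj)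
  then show "(\<integral>\<omega>. g \<omega> \<partial>push n (E_star X p D n \<mu>)) = (\<integral>\<omega>. g \<omega> \<partial>\<mu>)"
    by (simp add: push_integral[OF E_star_Prob[OF \<mu>] g] E_star_integral[OF \<mu>] Cont_comp_proj[OF g])
qed

text \<open>Integrating E_n f against the push-forward is integrating P_n f against \<nu>, so this
  is the invariance of \<nu> under P_n; it gives surjectivity onto S_{D_n}.\<close>

lemma E_star_push:
  assumes \<nu>: "\<nu> \<in> S_Dn X p D n" shows "E_star X p D n (push n \<nu>) = \<nu>"
proof (rule E_star_eqI[OF push_Prob[OF S_Dn_Prob[OF \<nu>]] S_Dn_Prob[OF \<nu>]])
  fix f assume f: "f \<in> Cont (X 0)"
  show "(\<integral>x. f x \<partial>\<nu>) = (\<integral>\<omega>. E n f \<omega> \<partial>push n \<nu>)"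
    by (simp add: push_integral[OF S_Dn_Prob[OF \<nu>] En_Cont[OF f]] S_Dn_integral[OF \<nu> f] Pn_apply)
qed

lemma E_star_image: "E_star X p D n ` Prob (X n) = S_Dn X p D n"
proof
  show "E_star X p D n ` Prob (X n) \<subseteq> S_Dn X p D n" using E_star_S_Dn by blast
  show "S_Dn X p D n \<subseteq> E_star X p D n ` Prob (X n)"
  proof
    fix \<nu> assume "\<nu> \<in> S_Dn X p D n"
    from E_star_push[OF this] push_Prob[OF S_Dn_Prob[OF this]]
    show "\<nu> \<in> E_star X p D n ` Prob (X n)" by (metis image_eqI)
  qed
qed

lemma E_star_continuous: "continuous_map (weak_star (X n)) (weak_star (X 0)) (E_star X p D n)"
proof (rule continuous_map_into_weak_star)
  show "E_star X p D n \<mu> \<in> Prob (X 0)" if "\<mu> \<in> topspace (weak_star (X n))" for \<mu>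
    using that by (simp add: topspace_weak_star E_star_Prob)
  fix f assume f: "f \<in> Cont (X 0)"
  show "continuous_map (weak_star (X n)) euclideanreal (\<lambda>\<mu>. \<integral>x. f x \<partial>E_star X p D n \<mu>)"
    by (rule continuous_map_eq[OF continuous_map_weak_star_integral[OF En_Cont[OF f, of n]]])
      (simp add: topspace_weak_star E_star_integral f)
qed

text \<open>Compact as a continuous image of \<open>Prob (X n)\<close>, which bypasses a proof that
  the invariance condition is closed.\<close>

lemma compactin_S_Dn: "compactin (weak_star (X 0)) (S_Dn X p D n)"
proof -
  have "compactin (weak_star (X n)) (Prob (X n))"
    using compact_weak_star_X[of n] by (simp add: compact_space_def topspace_weak_star)
  from image_compactin[OF this E_star_continuous] show ?thesis by (simp only: E_star_image)
qed

lemma compactin_S_D: "compactin (weak_star (X 0)) (S_D X p D)"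
  unfolding Inter_S_Dn[symmetric]
  by (rule closed_compactin_Inter[OF compactin_S_Dn[of 0]])
    (auto intro: compactin_imp_closedin[OF Hausdorff_weak_star_X compactin_S_Dn])

lemma S_Dn_mix:
  assumes \<mu>: "\<mu> \<in> S_Dn X p D n" and \<nu>: "\<nu> \<in> S_Dn X p D n" and t: "t \<in> {0..1}"
  shows "mix t \<mu> \<nu> \<in> S_Dn X p D n"
  unfolding S_Dn_iff is_comp_def
proof (intro conjI ballI mix_Prob S_Dn_Prob[OF \<mu>] S_Dn_Prob[OF \<nu>] t)
  fix f assume f: "f \<in> Cont (X 0)"
  show "(\<integral>x. f x \<partial>mix t \<mu> \<nu>) = (\<integral>x. P n f x \<partial>mix t \<mu> \<nu>)"
    unfolding integral_mix_X[OF S_Dn_Prob[OF \<mu>] S_Dn_Prob[OF \<nu>] t f]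
      integral_mix_X[OF S_Dn_Prob[OF \<mu>] S_Dn_Prob[OF \<nu>] t Pn_Cont[OF f]]
    by (simp only: S_Dn_integral[OF \<mu> f] S_Dn_integral[OF \<nu> f])
qed

lemma topspace_S_Dn: "topspace (subtopology (weak_star (X 0)) (S_Dn X p D n)) = S_Dn X p D n"
  by (rule topspace_subtopology_weak_star) (use S_Dn_Prob in blast)

lemma compact_convex_S_Dn: "compact_convex (subtopology (weak_star (X 0)) (S_Dn X p D n)) mix"
  unfolding compact_convex_def topspace_S_Dn
  by (simp add: compact_space_subtopology[OF compactin_S_Dn]
      Hausdorff_space_subtopology[OF Hausdorff_weak_star_X] S_Dn_mix)

lemma E_star_mix:
  assumes \<mu>: "\<mu> \<in> Prob (X n)" and \<nu>: "\<nu> \<in> Prob (X n)" and t: "t \<in> {0..1}"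
  shows "E_star X p D n (mix t \<mu> \<nu>) = mix t (E_star X p D n \<mu>) (E_star X p D n \<nu>)"
proof (rule E_star_eqI)
  fix f assume f: "f \<in> Cont (X 0)"
  show "(\<integral>x. f x \<partial>mix t (E_star X p D n \<mu>) (E_star X p D n \<nu>)) = (\<integral>\<omega>. E n f \<omega> \<partial>mix t \<mu> \<nu>)"
    unfolding integral_mix_X[OF E_star_Prob[OF \<mu>] E_star_Prob[OF \<nu>] t f]
      integral_mix_X[OF \<mu> \<nu> t En_Cont[OF f]]
    by (simp only: E_star_integral[OF \<mu> f] E_star_integral[OF \<nu> f])
qed (intro mix_Prob E_star_Prob \<mu> \<nu> t)+

lemma E_star_iso:
  "compact_convex_iso (weak_star (X n)) mix (subtopology (weak_star (X 0)) (S_Dn X p D n)) mix (E_star X p D n)"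
  unfolding compact_convex_iso_def
proof (intro conjI ballI compact_convex_weak_star_X compact_convex_S_Dn)
  show "homeomorphic_map (weak_star (X n)) (subtopology (weak_star (X 0)) (S_Dn X p D n)) (E_star X p D n)"
  \<comment> \<open>The source is compact and the target Hausdorff, so the inverse is continuous
    automatically.\<close>
  proof (rule continuous_imp_homeomorphic_map)
    show "continuous_map (weak_star (X n)) (subtopology (weak_star (X 0)) (S_Dn X p D n)) (E_star X p D n)"
      by (rule continuous_map_into_subtopology[OF E_star_continuous])
        (simp add: topspace_weak_star E_star_S_Dn)
    show "inj_on (E_star X p D n) (topspace (weak_star (X n)))"
      unfolding topspace_weak_star by (rule inj_on_inverseI[where g="push n"]) (rule push_E_star)
  qed (simp_all only: compact_weak_star_X Hausdorff_space_subtopology[OF Hausdorff_weak_star_X]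
      topspace_weak_star topspace_S_Dn E_star_image)
qed (simp add: topspace_weak_star E_star_mix)

section \<open>Compatible sequences of measures\<close>

lemma En_0: "\<omega> \<in> \<Omega> \<Longrightarrow> E 0 f \<omega> = f \<omega>"
  using En_comp_proj[of \<omega> 0 f] by simp

lemma S_E_integral:
  assumes m: "m \<in> S_E X p D" and f: "f \<in> Cont (X 0)"
  shows "(\<integral>x. f x \<partial>m 0) = (\<integral>\<omega>. E n f \<omega> \<partial>m n)"
proof (induction n)
  case 0
  have "m 0 \<in> Prob (X 0)" using m by (simp add: S_E_def)
  from Prob_integral_cong[OF this En_0] show ?case by simp
next
  case (Suc n)
  have "(\<integral>\<omega>. E n f \<omega> \<partial>m n) = (\<integral>\<omega>. E_step X p D n (E n f) \<omega> \<partial>m (Suc n))"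
    using m En_Cont[OF f, of n] by (simp add: S_E_def is_comp_def)
  with Suc show ?case by (simp only: E_step_En)
qed

lemma S_E_Prob: "m \<in> S_E X p D \<Longrightarrow> m n \<in> Prob (X n)"
  by (simp add: S_E_def)

lemma S_E_E_star: "m \<in> S_E X p D \<Longrightarrow> E_star X p D n (m n) = m 0"
  by (intro E_star_eqI S_E_Prob S_E_integral)

lemma S_E_S_D: "m \<in> S_E X p D \<Longrightarrow> m 0 \<in> S_D X p D"
proof -
  assume m: "m \<in> S_E X p D"
  have "m 0 \<in> S_Dn X p D n" for n
    using E_star_S_Dn[OF S_E_Prob[OF m, of n]] by (simp only: S_E_E_star[OF m])
  then show "m 0 \<in> S_D X p D" unfolding Inter_S_Dn[symmetric] by blast
qed

lemma S_D_S_Dn: "\<nu> \<in> S_D X p D \<Longrightarrow> \<nu> \<in> S_Dn X p D n"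
  unfolding Inter_S_Dn[symmetric] by blast

lemma S_D_Prob: "\<nu> \<in> S_D X p D \<Longrightarrow> \<nu> \<in> Prob (X 0)"
  by (rule S_Dn_Prob[OF S_D_S_Dn])

text \<open>Pulled back to X, E_{n+1,n} g is P_{n+1} of the pullback of g; compatibility at step n
  is thus invariance of \<nu> under P_{n+1}.\<close>

lemma push_S_E:
  assumes \<nu>: "\<nu> \<in> S_D X p D" shows "(\<lambda>n. push n \<nu>) \<in> S_E X p D"
  unfolding S_E_def is_comp_def
proof (intro CollectI conjI allI ballI push_Prob S_D_Prob[OF \<nu>])
  fix n g assume g: "g \<in> Cont (X n)"
  have "(\<integral>\<omega>. E_step X p D n g \<omega> \<partial>push (Suc n) \<nu>) = (\<integral>x. E_step X p D n g (\<pi> (Suc n) x) \<partial>\<nu>)"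
    by (rule push_integral[OF S_D_Prob[OF \<nu>] E_step_Cont[OF g]])
  also have "\<dots> = (\<integral>x. P (Suc n) (\<lambda>x. g (\<pi> n x)) x \<partial>\<nu>)"
    by (simp only: E_step_eq_En Pn_apply)
  also have "\<dots> = (\<integral>x. g (\<pi> n x) \<partial>\<nu>)"
    by (rule S_Dn_integral[OF S_D_S_Dn[OF \<nu>] Cont_comp_proj[OF g], symmetric])
  also have "\<dots> = (\<integral>\<omega>. g \<omega> \<partial>push n \<nu>)" by (rule push_integral[OF S_D_Prob[OF \<nu>] g, symmetric])
  finally show "(\<integral>\<omega>. g \<omega> \<partial>push n \<nu>) = (\<integral>\<omega>. E_step X p D n g \<omega> \<partial>push (Suc n) \<nu>)" by (rule sym)
qed

lemma push_0: "\<nu> \<in> Prob (X 0) \<Longrightarrow> push 0 \<nu> = \<nu>"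
proof -
  assume \<nu>: "\<nu> \<in> Prob (X 0)"
  show "push 0 \<nu> = \<nu>"
    by (rule Prob_eqI_X[OF push_Prob[OF \<nu>] \<nu>]) (simp add: push_integral[OF \<nu>])
qed

lemma push_S_E_inverse: "m \<in> S_E X p D \<Longrightarrow> push n (m 0) = m n"
  using push_E_star[OF S_E_Prob, of m n] by (simp add: S_E_E_star)

lemma topspace_S_E: "topspace (S_E_top X p D) = S_E X p D"
  by (auto simp: S_E_top_def topspace_weak_star S_E_Prob)

lemma topspace_S_D: "topspace (subtopology (weak_star (X 0)) (S_D X p D)) = S_D X p D"
  by (rule topspace_subtopology_weak_star) (use S_D_Prob in blast)

text \<open>Compactness of \<open>S_E_top\<close> is not yet available, so both directions are shown
  continuous explicitly. Coordinate n of the inverse is tested on f by integrating f \<circ>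
  \<pi>_n.\<close>

lemma S_E_homeomorphic_maps:
  "homeomorphic_maps (S_E_top X p D) (subtopology (weak_star (X 0)) (S_D X p D)) (\<lambda>m. m 0) (\<lambda>\<nu> n. push n \<nu>)"
  unfolding homeomorphic_maps_def topspace_S_E topspace_S_D
proof (intro conjI ballI)
  show "continuous_map (S_E_top X p D) (subtopology (weak_star (X 0)) (S_D X p D)) (\<lambda>m. m 0)"
  proof (rule continuous_map_into_subtopology)
    show "continuous_map (S_E_top X p D) (weak_star (X 0)) (\<lambda>m. m 0)"
      unfolding S_E_top_def
      by (intro continuous_map_from_subtopology continuous_map_product_projection) simp
  qed (simp add: topspace_S_E S_E_S_D)
  show "continuous_map (subtopology (weak_star (X 0)) (S_D X p D)) (S_E_top X p D) (\<lambda>\<nu> n. push n \<nu>)"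
    unfolding S_E_top_def
  proof (rule continuous_map_into_subtopology)
    show "continuous_map (subtopology (weak_star (X 0)) (S_D X p D))
        (product_topology (\<lambda>n. weak_star (X n)) UNIV) (\<lambda>\<nu> n. push n \<nu>)"
      unfolding continuous_map_componentwise_UNIV
    proof (intro allI continuous_map_into_weak_star)
      fix n f assume f: "f \<in> Cont (X n)"
      have "continuous_map (subtopology (weak_star (X 0)) (S_D X p D)) euclideanreal (\<lambda>\<nu>. \<integral>x. f (\<pi> n x) \<partial>\<nu>)"
        by (intro continuous_map_from_subtopology continuous_map_weak_star_integral Cont_comp_proj f)
      then show "continuous_map (subtopology (weak_star (X 0)) (S_D X p D)) euclideanreal (\<lambda>\<nu>. \<integral>\<omega>. f \<omega> \<partial>push n \<nu>)"
        by (rule continuous_map_eq) (simp only: topspace_S_D push_integral[OF S_D_Prob f])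
    qed (simp only: topspace_S_D push_Prob[OF S_D_Prob])
  qed (simp only: topspace_S_D push_S_E Pi_I)
qed (simp_all add: push_S_E_inverse push_0 S_D_Prob)

lemma S_E_mix:
  assumes m: "m \<in> S_E X p D" and m': "m' \<in> S_E X p D" and t: "t \<in> {0..1}"
  shows "(\<lambda>n. mix t (m n) (m' n)) \<in> S_E X p D"
  unfolding S_E_def is_comp_def
proof (intro CollectI conjI allI ballI mix_Prob S_E_Prob m m' t)
  fix n f assume f: "f \<in> Cont (X n)"
  show "(\<integral>x. f x \<partial>mix t (m n) (m' n)) = (\<integral>\<omega>. E_step X p D n f \<omega> \<partial>mix t (m (Suc n)) (m' (Suc n)))"
    unfolding integral_mix_X[OF S_E_Prob[OF m] S_E_Prob[OF m'] t f]
      integral_mix_X[OF S_E_Prob[OF m] S_E_Prob[OF m'] t E_step_Cont[OF f]]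
    using m m' f by (simp add: S_E_def is_comp_def)
qed

lemma compact_convex_S_D: "compact_convex (subtopology (weak_star (X 0)) (S_D X p D)) mix"
proof -
  have "mix t \<mu> \<nu> \<in> S_D X p D" if "t \<in> {0..1}" "\<mu> \<in> S_D X p D" "\<nu> \<in> S_D X p D" for t \<mu> \<nu>
    using that unfolding Inter_S_Dn[symmetric] by (auto intro: S_Dn_mix)
  then show ?thesis
    unfolding compact_convex_def topspace_S_D
    by (simp add: compact_space_subtopology[OF compactin_S_D]
        Hausdorff_space_subtopology[OF Hausdorff_weak_star_X])
qed

lemma S_E_iso:
  "compact_convex_iso (S_E_top X p D) (\<lambda>t m m' n. mix t (m n) (m' n))
     (subtopology (weak_star (X 0)) (S_D X p D)) mix (\<lambda>m. m 0)"
proof -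
  have hom: "S_E_top X p D homeomorphic_space subtopology (weak_star (X 0)) (S_D X p D)"
    using S_E_homeomorphic_maps unfolding homeomorphic_space_def by blast
  \<comment> \<open>Compactness and separation are transported from S_D, which avoids showing that
    \<open>S_E\<close> is closed in the product.\<close>
  have "compact_convex (S_E_top X p D) (\<lambda>t m m' n. mix t (m n) (m' n))"
    using compact_convex_S_D S_E_mix
    by (simp add: compact_convex_def homeomorphic_compact_space[OF hom]
        homeomorphic_Hausdorff_space[OF hom] topspace_S_E)
  moreover have "homeomorphic_map (S_E_top X p D) (subtopology (weak_star (X 0)) (S_D X p D)) (\<lambda>m. m 0)"
    using S_E_homeomorphic_maps by (simp add: homeomorphic_maps_map)
  ultimately show ?thesis using compact_convex_S_D by (simp add: compact_convex_iso_def)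
qed

end

theorem proposition3p7:
  fixes X :: "nat \<Rightarrow> 'a topology" and p :: "nat \<Rightarrow> 'a \<Rightarrow> 'a" and D :: "'a \<times> 'a \<Rightarrow> real"
  assumes "AP_sequence X p"
    and "D \<in> cocycles (R_top X p)"
  shows
    "(decseq (S_Dn X p D) \<and> (\<Inter>n. S_Dn X p D n) = S_D X p D) \<and>
     (\<forall>n. compact_convex_iso
        (weak_star (X n)) mix
        (subtopology (weak_star (X 0)) (S_Dn X p D n)) mix
        (E_star X p D n)) \<and>
     (\<forall>m\<in>S_E X p D. \<forall>n. E_star X p D n (m n) = m 0) \<and>
     compact_convex_iso
        (S_E_top X p D) (\<lambda>t m m' n. mix t (m n) (m' n))
        (subtopology (weak_star (X 0)) (S_D X p D)) mix
        (\<lambda>m. m 0) \<and>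
     S_D X p D = G_measures X p D"
proof -
  interpret AP_cocycle X p D by unfold_locales (rule assms)+
  show ?thesis
    by (intro conjI allI ballI decseq_S_Dn Inter_S_Dn E_star_iso S_E_E_star S_E_iso S_D_eq_G_measures)
qed

end
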